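(* Let $\mathcal{S}=(A,B,C,\mathcal{N},\mathcal{M})$ be a BQO system with $A$ stable and initial state $x(0)=0$, and suppose that the equation $$AP+PA^T+\sum_{k=1}^mN_kPN_k^T+BB^T=0$$ has a unique solution $P\in\mathbb{R}^{n\times n}$, which is symmetric positive semidefinite. Then for every input $u\in L^2([0,\infty),\mathbb{R}^m)$ the output $y$ of $\mathcal{S}$ satisfies $$\sup_{t\ge0}\|y(t)\|_2^2\le\|\mathcal{S}\|_{\mathcal{H}_2}^2\left(e^{\|u^0\|_{L^2}^2}\|u\|_{L^2}^2+e^{2\|u^0\|_{L^2}^2}\|u\otimes u\|_{L^2}^2\right).$$
   Context: A BQO (bilinear quadratic output) system $\mathcal{S}=(A,B,C,\mathcal{N},\mathcal{M})$ of order $n$ with $m$ inputs and $p$ outputs is $$\dot x(t)=Ax(t)+\sum_{k=1}^mN_kx(t)u_k(t)+Bu(t),\quad x(0)=0,\qquad y(t)=Cx(t)+[x(t)^TM_1x(t),\dots,x(t)^TM_px(t)]^T,\quad t\in[0,\infty),$$ with $A,N_k\in\mathbb{R}^{n\times n}$, $B\in\mathbb{R}^{n\times m}$, $C\in\mathbb{R}^{p\times n}$, symmetric $M_j\in\mathbb{R}^{n\times n}$, $\mathcal{N}=[N_1\,\dots\,N_m]$, $\mathcal{M}=[M_1\,\dots\,M_p]$. Stable means all eigenvalues of $A$ have negative real part. Set $\mathfrak{M}=[\operatorname{vec}(M_1)\,\dots\,\operatorname{vec}(M_p)]^T\in\mathbb{R}^{p\times n^2}$. $\mathcal{H}_2$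 norm: let $\bar P_1(t_1)=e^{At_1}B$ and $\bar P_i(t_1,\dots,t_i)=e^{At_i}\mathcal{N}(I_m\otimes\bar P_{i-1}(t_1,\dots,t_{i-1}))$ for $i\ge2$; $h_{C,i}=C\bar P_i(t_1,\dots,t_i)$, $h_{M,i,j}=\mathfrak{M}(\bar P_i(t_1,\dots,t_i)\otimes\bar P_j(\bar t_1,\dots,\bar t_j))$. Then $$\|\mathcal{S}\|_{\mathcal{H}_2}^2=\sum_{i=1}^\infty\int_0^\infty\!\!\cdots\!\int_0^\infty\|h_{C,i}\|_F^2\,dt_1\cdots dt_i+\sum_{i,j=1}^\infty\int_0^\infty\!\!\cdots\!\int_0^\infty\|h_{M,i,j}\|_F^2\,dt_1\cdots dt_i\,d\bar t_1\cdots d\bar t_j.$$ Input norms: $\|u\|_{L^2}^2=\int_0^\infty\|u(s)\|_2^2\,ds$; $u^0=[u^0_1,\dots,u^0_m]^T$ with $u^0_k=0$ if $N_k=0$ and $u^0_k=u_k$ otherwise; $\|u\otimes u\|_{L^2}^2=\int_0^\infty\int_0^\infty\|u(s_1)\otimes u(s_2)\|_2^2\,ds_1\,ds_2$. *)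

theory Defs
  imports "HOL-Analysis.Analysis"
begin

section \<open>Matrices\<close>

definition mat_exp :: "real^'n^'n \<Rightarrow> real^'n^'n" where
  "mat_exp A = (\<Sum>k. (1 / fact k) *\<^sub>R (((\<lambda>X. A ** X) ^^ k) (mat 1)))"

definition stable :: "real^'n^'n \<Rightarrow> bool" where
  "stable A \<longleftrightarrow>
     (\<forall>(\<mu>::complex) v. v \<noteq> 0 \<and> map_matrix complex_of_real A *v v = \<mu> *s v \<longrightarrow> Re \<mu> < 0)"

definition symmetric_psd :: "real^'n^'n \<Rightarrow> bool" where
  "symmetric_psd P \<longleftrightarrow> transpose P = P \<and> (\<forall>v. 0 \<le> v \<bullet> (P *v v))"

definition kron_vec :: "real^'a \<Rightarrow> real^'b \<Rightarrow> real^('a \<times> 'b)" where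
  "kron_vec v w = (\<chi> q. v $ fst q * w $ snd q)"

text \<open>
  The kernels are matrices with \<open>n\<close> rows (or \<open>p\<close> rows) and \<open>m\<^sup>i\<close> columns, where \<open>i\<close> varies.
  Such a matrix is represented by the family of its columns: the columns are indexed by the
  words of length \<open>i\<close> over the input index type, the lexicographic order of the words being the
  order of the columns in a Kronecker product. Only the values on the relevant finite index set
  (\<open>words i\<close>, or a product of two such sets) matter. The product of \<open>X\<close> with the
  family \<open>Y\<close> has the columns \<open>X *v Y c\<close>, and the column of a Kronecker product with index
  \<open>(c, d)\<close> is the Kronecker product of the columns with indices \<open>c\<close> and \<open>d\<close>.
\<close>

definition words :: "nat \<Rightarrow> 'm list set" where
  "words i = {l. length l = i}"

definition kron_cols :: "('c \<Rightarrow> real^'a) \<Rightarrow> ('d \<Rightarrow> real^'b) \<Rightarrow> 'c \<times> 'd \<Rightarrow> real^('a \<times> 'b)" where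
  "kron_cols X Y = (\<lambda>(c, d). kron_vec (X c) (Y d))"

definition frobenius_sq :: "'c set \<Rightarrow> ('c \<Rightarrow> real^'a) \<Rightarrow> real" where
  "frobenius_sq I X = (\<Sum>c\<in>I. (norm (X c))\<^sup>2)"

section \<open>Systems with bilinear dynamics and quadratic output\<close>

text \<open>The block matrix \<open>[N\<^sub>1 \<dots> N\<^sub>m]\<close>; column \<open>(k, s)\<close> is the \<open>s\<close>-th column of \<open>N k\<close>.\<close>

definition N_block :: "('m::finite \<Rightarrow> real^'n^'n) \<Rightarrow> real^('m \<times> 'n)^'n" where
  "N_block N = (\<chi> r ks. N (fst ks) $ r $ snd ks)"

text \<open>The matrix with rows \<open>vec (M\<^sub>j)\<^sup>T\<close>; \<open>vec\<close> stacks the columns, so entry \<open>(c, r)\<close> of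
  \<open>vec (M\<^sub>j)\<close> is in column \<open>c\<close> and row \<open>r\<close> of \<open>M\<^sub>j\<close>.\<close>

definition M_vec :: "('p \<Rightarrow> real^('n::finite)^'n) \<Rightarrow> real^('n \<times> 'n)^'p" where
  "M_vec M = (\<chi> j cr. M j $ snd cr $ fst cr)"

text \<open>
  For locally square integrable \<open>u\<close> the differential equation is understood in the sense of
  Caratheodory, that is, in integrated form with a Lebesgue integrable right-hand side.
\<close>

definition bqo_rhs ::
  "real^'n^'n \<Rightarrow> real^'m^'n \<Rightarrow> ('m \<Rightarrow> real^'n^'n) \<Rightarrow> real^'m \<Rightarrow> real^'n \<Rightarrow> real^'n" where
  "bqo_rhs A B N w z = A *v z + (\<Sum>k\<in>UNIV. w $ k *\<^sub>R (N k *v z)) + B *v w"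

definition bqo_state ::
  "real^'n^'n \<Rightarrow> real^'m^'n \<Rightarrow> ('m \<Rightarrow> real^'n^'n) \<Rightarrow> (real \<Rightarrow> real^'m) \<Rightarrow> (real \<Rightarrow> real^'n) \<Rightarrow> bool" where
  "bqo_state A B N u x \<longleftrightarrow>
     x 0 = 0 \<and>
     (\<forall>t\<ge>0. (\<lambda>s. bqo_rhs A B N (u s) (x s)) absolutely_integrable_on {0..t} \<and>
            x t = integral {0..t} (\<lambda>s. bqo_rhs A B N (u s) (x s)))"

definition bqo_output ::
  "real^'n^'n \<Rightarrow> real^'m^'n \<Rightarrow> real^'n^'p \<Rightarrow> ('m \<Rightarrow> real^'n^'n) \<Rightarrow> ('p \<Rightarrow> real^'n^'n)
     \<Rightarrow> (real \<Rightarrow> real^'m) \<Rightarrow> (real \<Rightarrow> real^'p) \<Rightarrow> bool" where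
  "bqo_output A B C N M u y \<longleftrightarrow>
     (\<exists>x. bqo_state A B N u x \<and>
          (\<forall>t\<ge>0. y t = C *v x t + (\<chi> j. x t \<bullet> (M j *v x t))))"

section \<open>The H2 norm\<close>

text \<open>
  \<open>P_bar A B N i t\<close> is the kernel of index \<open>i \<ge> 1\<close> at the times \<open>t 1, \<dots>, t i\<close>, as a family
  of columns over \<open>words i\<close>; the value at index 0 is a dummy.
\<close>

fun P_bar ::
  "real^'n^'n \<Rightarrow> real^'m^'n \<Rightarrow> ('m \<Rightarrow> real^'n^'n) \<Rightarrow> nat \<Rightarrow> (nat \<Rightarrow> real) \<Rightarrow> 'm list \<Rightarrow> real^'n" where
  "P_bar A B N 0 t = (\<lambda>l. 0)"
| "P_bar A B N (Suc 0) t = (\<lambda>l. mat_exp (t 1 *\<^sub>R A) *v column (hd l) B)"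
| "P_bar A B N (Suc (Suc i)) t =
     (\<lambda>l. (mat_exp (t (Suc (Suc i)) *\<^sub>R A) ** N_block N) *v
            kron_cols (\<lambda>k. column k (mat 1)) (P_bar A B N (Suc i) t) (hd l, tl l))"

definition h_C ::
  "real^'n^'n \<Rightarrow> real^'m^'n \<Rightarrow> real^'n^'p \<Rightarrow> ('m \<Rightarrow> real^'n^'n)
     \<Rightarrow> nat \<Rightarrow> (nat \<Rightarrow> real) \<Rightarrow> 'm list \<Rightarrow> real^'p" where
  "h_C A B C N i t = (\<lambda>l. C *v P_bar A B N i t l)"

definition h_M ::
  "real^'n^'n \<Rightarrow> real^'m^'n \<Rightarrow> ('m \<Rightarrow> real^'n^'n) \<Rightarrow> ('p \<Rightarrow> real^'n^'n)
     \<Rightarrow> nat \<Rightarrow> nat \<Rightarrow> (nat \<Rightarrow> real) \<Rightarrow> (nat \<Rightarrow> real) \<Rightarrow> 'm list \<times> 'm list \<Rightarrow> real^'p" where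
  "h_M A B N M i j t s =
     (\<lambda>q. M_vec M *v kron_cols (P_bar A B N i t) (P_bar A B N j s) q)"

definition orthant :: "nat \<Rightarrow> (nat \<Rightarrow> real) measure" where
  "orthant i = PiM {1..i} (\<lambda>_. restrict_space lborel {0..})"

definition h2_norm_sq ::
  "real^'n^'n \<Rightarrow> real^'m^'n \<Rightarrow> real^'n^'p \<Rightarrow> ('m \<Rightarrow> real^'n^'n) \<Rightarrow> ('p \<Rightarrow> real^'n^'n) \<Rightarrow> ennreal" where
  "h2_norm_sq A B C N M =
     (\<Sum>i. \<integral>\<^sup>+ t. ennreal (frobenius_sq (words (Suc i)) (h_C A B C N (Suc i) t)) \<partial>orthant (Suc i)) +
     (\<Sum>i. \<Sum>j. \<integral>\<^sup>+ t. \<integral>\<^sup>+ s.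
         ennreal (frobenius_sq (words (Suc i) \<times> words (Suc j)) (h_M A B N M (Suc i) (Suc j) t s))
         \<partial>orthant (Suc j) \<partial>orthant (Suc i))"

section \<open>Inputs\<close>

definition L2_input :: "(real \<Rightarrow> real^'m) \<Rightarrow> bool" where
  "L2_input u \<longleftrightarrow> u \<in> borel_measurable (lebesgue_on {0..}) \<and>
     integrable (lebesgue_on {0..}) (\<lambda>s. (norm (u s))\<^sup>2)"

definition L2_norm_sq :: "(real \<Rightarrow> real^'m) \<Rightarrow> real" where
  "L2_norm_sq u = (LINT s|lebesgue_on {0..}. (norm (u s))\<^sup>2)"

definition L2_norm_sq_kron :: "(real \<Rightarrow> real^'m) \<Rightarrow> real" where
  "L2_norm_sq_kron u =
     (LINT s1|lebesgue_on {0..}. (LINT s2|lebesgue_on {0..}. (norm (kron_vec (u s1) (u s2)))\<^sup>2))"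

definition input0 :: "('m \<Rightarrow> real^'n^'n) \<Rightarrow> (real \<Rightarrow> real^'m) \<Rightarrow> real \<Rightarrow> real^'m" where
  "input0 N u s = (\<chi> k. if N k = 0 then 0 else u s $ k)"

end

theory Submission
  imports Defs
begin

text \<open>
  The state is the sum of its Volterra series: \<open>x = x\<^sub>0 + x\<^sub>1 + \<dots>\<close>, where \<open>x\<^sub>0\<close> is
  the response of \<open>z' = A z\<close> to the forcing \<open>B u\<close> and \<open>x\<^sub>i\<^sub>+\<^sub>1\<close> the response to the forcing
  \<open>\<Sum>k. u\<^sub>k N\<^sub>k x\<^sub>i\<close>. Written out, \<open>x\<^sub>i(t)\<close> is an integral over a simplex of the kernel with index \<open>i + 1\<close>
  against an \<open>(i + 1)\<close>-fold product of inputs, and the theorem is the Cauchy-Schwarz inequality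
  for the inner product of all the kernels with all these products. The squared norm of the kernels
  gives the H2 norm. In the other factor, the first input to act enters through \<open>B\<close> and each later one through an
  \<open>N\<^sub>k\<close>, so it is counted by \<open>u\<close> once and by \<open>u\<^sup>0\<close> otherwise; the simplex has the volume factor
  \<open>1 / i!\<close>, whence the exponential series.

  The Cauchy-Schwarz inequality is applied one time variable at a time, so that the iterated integrals
  of the state never have to be written out. Two recursions run in parallel. The
  quadratic form of the Gramian of a kernel, \<open>gramian_form\<close>, satisfies
  \<open>G\<^sub>i\<^sub>+\<^sub>1(v) = \<integral> \<Sum>k. G\<^sub>i(N\<^sub>k\<^sup>T e\<^bsup>A\<^sup>T \<tau>\<^esup> v) d\<tau>\<close> (\<open>gramian_form_Suc\<close>), and the
  integrals of the inputs, \<open>weight\<close>, satisfy \<open>c\<^sub>i\<^sub>+\<^sub>1(t) = \<integral> |u\<^sup>0(s)|\<^sup>2 c\<^sub>i(s) ds\<close> over \<open>[0, t]\<close>. Induction then gives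
  \<open>(v \<bullet> x\<^sub>i(t))\<^sup>2 \<le> c\<^sub>i(t) G\<^sub>i\<^sub>+\<^sub>1(v)\<close> for all \<open>v\<close> (\<open>volterra_sq_le\<close>).
  With \<open>v\<close> running over the rows of \<open>C\<close> this bounds \<open>C x\<^sub>i\<close> (\<open>linear_output_le\<close>); applied
  in each of the two arguments it bounds \<open>x\<^sub>j\<^sup>T M x\<^sub>i\<close> (\<open>quadratic_output_le\<close>). In both cases the
  Gramian forms add up to an integral that occurs in the H2 norm. A last Cauchy-Schwarz inequality for
  the finite sums of these terms, and a passage to the limit, give the claim
  (\<open>output_at_time_le\<close>).

  All bounds are between extended nonnegative reals, so an infinite Gramian form or an infinite H2 norm is
  covered by the same argument.

  Inputs are merely square integrable, so the state is only absolutely continuous. What is needed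
  of the calculus of such functions, the variation of constants formula and
  \<open>\<integral> \<rho> U\<^sup>k / k! = U\<^sup>k\<^sup>+\<^sup>1 / (k+1)!\<close> for \<open>U = \<integral> \<rho>\<close>, comes from integration by parts
  (\<open>integral_by_parts_absolutely_continuous\<close>).
\<close>

section \<open>Integration by parts for absolutely continuous functions\<close>

text \<open>
  Cutting \<open>[0, T]\<close> into short pieces and adding up bounds the total increment by \<open>e * (V T - V 0)\<close>
  for every \<open>e > 0\<close>. This replaces differentiation for functions that have no derivative
  everywhere.
\<close>

lemma eq_if_increments_small:
  fixes G :: "real \<Rightarrow> 'a::real_normed_vector" and V :: "real \<Rightarrow> real"
  assumes T: "0 \<le> T"
    and small: "\<And>e. e > 0 \<Longrightarrow> \<exists>d>0. \<forall>a b. 0 \<le> a \<and> a \<le> b \<and> b \<le> T \<and> b - a < d \<longrightarrow>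
                  norm (G b - G a) \<le> e * (V b - V a)"
  shows "G T = G 0"
proof (cases "T = 0")
  case False
  have bound: "norm (G T - G 0) \<le> e * (V T - V 0)" if "e > 0" for e
  proof -
    obtain d where "d > 0" and d': "\<forall>a b. 0 \<le> a \<and> a \<le> b \<and> b \<le> T \<and> b - a < d \<longrightarrow>
        norm (G b - G a) \<le> e * (V b - V a)"
      using small[OF \<open>e > 0\<close>] by (elim exE conjE)
    have d: "norm (G b - G a) \<le> e * (V b - V a)" if "0 \<le> a" "a \<le> b" "b \<le> T" "b - a < d" for a b
      using d' that by simp
    obtain n :: nat where n: "T / d < real n"
      using reals_Archimedean2 by blast
    have "0 < real n" using n T \<open>d > 0\<close> by (smt (verit) divide_nonneg_nonneg)
    define h where "h = T / real n"
    have h: "0 \<le> h" "h < d" "real n * h = T"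
      using n T \<open>d > 0\<close> \<open>0 < real n\<close> by (auto simp: h_def field_simps)
    have "norm (G (real k * h) - G 0) \<le> e * (V (real k * h) - V 0)" if "k \<le> n" for k
      using that
    proof (induction k)
      case (Suc k)
      have "real (Suc k) * h \<le> real n * h"
        using Suc.prems h(1) by (intro mult_right_mono) auto
      hence "norm (G (real (Suc k) * h) - G (real k * h)) \<le> e * (V (real (Suc k) * h) - V (real k * h))"
        using h by (intro d) (auto simp: algebra_simps)
      moreover have "norm (G (real (Suc k) * h) - G 0)
          \<le> norm (G (real (Suc k) * h) - G (real k * h)) + norm (G (real k * h) - G 0)"
        using norm_triangle_ineq[of "G (real (Suc k) * h) - G (real k * h)" "G (real k * h) - G 0"] by simp
      ultimately show ?case
        using Suc by (simp add: algebra_simps)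
    qed simp
    from this[of n] h show ?thesis by simp
  qed
  have "norm (G T - G 0) \<le> 0"
  proof (rule field_le_epsilon)
    fix e :: real assume "e > 0"
    let ?D = "\<bar>V T - V 0\<bar> + 1"
    have "norm (G T - G 0) \<le> e / ?D * (V T - V 0)"
      using \<open>e > 0\<close> by (intro bound) auto
    also have "\<dots> \<le> e / ?D * ?D"
      using \<open>e > 0\<close> by (intro mult_left_mono) auto
    finally show "norm (G T - G 0) \<le> 0 + e" by simp
  qed
  thus ?thesis by simp
qed simp

lemma absolutely_integrable_bilinear_continuous:
  fixes prod :: "'a::euclidean_space \<Rightarrow> 'b::euclidean_space \<Rightarrow> 'c::euclidean_space" and a b :: real
  assumes prod: "bounded_bilinear prod"
    and f: "f absolutely_integrable_on {a..b}" and g: "continuous_on {a..b} g"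
  shows "(\<lambda>s. prod (f s) (g s)) absolutely_integrable_on {a..b}"
proof -
  have "bilinear (\<lambda>x y. prod y x)"
    using bounded_bilinear.flip[OF prod] by (simp add: bilinear_conv_bounded_bilinear)
  moreover have "g \<in> borel_measurable (lebesgue_on {a..b})"
    using g by (intro continuous_imp_measurable_on_sets_lebesgue) auto
  moreover have "bounded (g ` {a..b})"
    using g by (intro compact_imp_bounded compact_continuous_image) auto
  ultimately show ?thesis
    using absolutely_integrable_bounded_measurable_product[of "\<lambda>x y. prod y x" g "{a..b}" f] f by simp
qed

lemma absolutely_integrable_continuous_bilinear:
  fixes prod :: "'a::euclidean_space \<Rightarrow> 'b::euclidean_space \<Rightarrow> 'c::euclidean_space" and a b :: real
  assumes prod: "bounded_bilinear prod"
    and f: "continuous_on {a..b} f" and g: "g absolutely_integrable_on {a..b}"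
  shows "(\<lambda>s. prod (f s) (g s)) absolutely_integrable_on {a..b}"
  using absolutely_integrable_bilinear_continuous[OF bounded_bilinear.flip[OF prod] g f] .

lemma absolutely_integrable_norm_on:
  fixes f :: "'a::euclidean_space \<Rightarrow> 'b::euclidean_space"
  assumes "f absolutely_integrable_on S"
  shows "(\<lambda>x. norm (f x)) absolutely_integrable_on S"
  by (rule nonnegative_absolutely_integrable_1)
     (use assms in \<open>auto simp: absolutely_integrable_on_def\<close>)

text \<open>
  The difference of the two sides, as a function of the upper limit, has the increment
  \<open>\<integral> f'(s) (g b - g s) + (f a - f s) g'(s) ds\<close> over \<open>[a, b]\<close>. By uniform continuity of \<open>f\<close> and
  \<open>g\<close> this is small compared with \<open>\<integral> |f'| + |g'|\<close>, so the difference is constant.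
\<close>

lemma integral_by_parts_absolutely_continuous:
  fixes prod :: "'a::euclidean_space \<Rightarrow> 'b::euclidean_space \<Rightarrow> 'c::euclidean_space"
    and f f' :: "real \<Rightarrow> 'a" and g g' :: "real \<Rightarrow> 'b" and T :: real
  assumes prod: "bounded_bilinear prod" and T: "0 \<le> T"
    and f': "f' absolutely_integrable_on {0..T}" and g': "g' absolutely_integrable_on {0..T}"
    and f: "\<And>t. t \<in> {0..T} \<Longrightarrow> f t = f 0 + integral {0..t} f'"
    and g: "\<And>t. t \<in> {0..T} \<Longrightarrow> g t = g 0 + integral {0..t} g'"
  shows "integral {0..T} (\<lambda>s. prod (f' s) (g s) + prod (f s) (g' s)) = prod (f T) (g T) - prod (f 0) (g 0)"
proof -
  interpret P: bounded_bilinear prod by (rule prod)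
  obtain K where K: "K > 0" "\<And>x y. norm (prod x y) \<le> norm x * norm y * K"
    using P.pos_bounded by blast
  have cont: "continuous_on {0..T} f" "continuous_on {0..T} g"
  proof -
    have "f' integrable_on {0..T}" "g' integrable_on {0..T}"
      using f' g' by (auto simp: absolutely_integrable_on_def)
    note this(1)[THEN indefinite_integral_continuous_1] this(2)[THEN indefinite_integral_continuous_1]
    hence "continuous_on {0..T} (\<lambda>t. f 0 + integral {0..t} f')" "continuous_on {0..T} (\<lambda>t. g 0 + integral {0..t} g')"
      by (auto intro: continuous_on_add continuous_on_const)
    thus "continuous_on {0..T} f" "continuous_on {0..T} g"
      by (simp_all only: f g cong: continuous_on_cong)
  qed
  let ?H = "\<lambda>s. prod (f' s) (g s) + prod (f s) (g' s)"
  have "?H absolutely_integrable_on {0..T}"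
    using absolutely_integrable_bilinear_continuous[OF prod f' cont(2)]
      absolutely_integrable_continuous_bilinear[OF prod cont(1) g'] by (rule set_integral_add)
  hence H: "?H integrable_on {0..T}" by (simp add: absolutely_integrable_on_def)
  let ?v = "\<lambda>s. norm (f' s) + norm (g' s)"
  have v: "?v integrable_on {0..T}"
    using f' g' by (auto simp: absolutely_integrable_on_def intro: integrable_add)
  define G where "G = (\<lambda>t. prod (f t) (g t) - integral {0..t} ?H)"
  define V where "V = (\<lambda>t. integral {0..t} ?v)"
  have split: "integral {0..b} F - integral {0..a} F = integral {a..b} F"
    if "F integrable_on {0..T}" "0 \<le> a" "a \<le> b" "b \<le> T" for F :: "real \<Rightarrow> 'd::banach" and a b
    using Henstock_Kurzweil_Integration.integral_combine[of 0 a b F]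
      integrable_on_subinterval[OF that(1), of 0 b] that by (auto simp: algebra_simps)
  have "G T = G 0"
  proof (rule eq_if_increments_small[OF T])
    fix e :: real assume "e > 0"
    define e' where "e' = e / K"
    have "e' > 0" using \<open>e > 0\<close> K by (simp add: e'_def)
    obtain d1 where d1: "d1 > 0" "\<And>x y. x \<in> {0..T} \<Longrightarrow> y \<in> {0..T} \<Longrightarrow> dist y x < d1 \<Longrightarrow> dist (f y) (f x) < e'"
      using compact_uniformly_continuous[OF cont(1) compact_Icc] \<open>e' > 0\<close>
      unfolding uniformly_continuous_on_def by metis
    obtain d2 where d2: "d2 > 0" "\<And>x y. x \<in> {0..T} \<Longrightarrow> y \<in> {0..T} \<Longrightarrow> dist y x < d2 \<Longrightarrow> dist (g y) (g x) < e'"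
      using compact_uniformly_continuous[OF cont(2) compact_Icc] \<open>e' > 0\<close>
      unfolding uniformly_continuous_on_def by metis
    have "norm (G b - G a) \<le> e * (V b - V a)"
      if ab: "0 \<le> a" "a \<le> b" "b \<le> T" "b - a < min d1 d2" for a b
    proof -
      have sub: "F integrable_on {a..b}" if "F integrable_on {0..T}" for F :: "real \<Rightarrow> 'd::banach"
        using integrable_on_subinterval[OF that] ab by auto
      have if': "f' integrable_on {0..T}" "g' integrable_on {0..T}"
        using f' g' by (auto simp: absolutely_integrable_on_def)
      have fb: "f b - f a = integral {a..b} f'"
        using f[of a] f[of b] split[of f' a b] if' ab by (simp add: algebra_simps)
      have gb: "g b - g a = integral {a..b} g'"
        using g[of a] g[of b] split[of g' a b] if' ab by (simp add: algebra_simps)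
      have lin1: "integral {a..b} (\<lambda>s. prod (f' s) (g b)) = prod (integral {a..b} f') (g b)"
          "(\<lambda>s. prod (f' s) (g b)) integrable_on {a..b}"
        using integral_linear[OF sub[OF if'(1)] P.bounded_linear_left[of "g b"]]
          integrable_linear[OF sub[OF if'(1)] P.bounded_linear_left[of "g b"]] by (simp_all add: o_def)
      have lin2: "integral {a..b} (\<lambda>s. prod (f a) (g' s)) = prod (f a) (integral {a..b} g')"
          "(\<lambda>s. prod (f a) (g' s)) integrable_on {a..b}"
        using integral_linear[OF sub[OF if'(2)] P.bounded_linear_right[of "f a"]]
          integrable_linear[OF sub[OF if'(2)] P.bounded_linear_right[of "f a"]] by (simp_all add: o_def)
      have "G b - G a = prod (f b - f a) (g b) + prod (f a) (g b - g a) - integral {a..b} ?H"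
        unfolding G_def using split[OF H ab(1-3)] by (simp add: P.diff_left P.diff_right algebra_simps)
      also have "\<dots> = integral {a..b} (\<lambda>s. (prod (f' s) (g b) + prod (f a) (g' s)) - ?H s)"
        unfolding fb gb
        by (simp only: integral_diff[OF integrable_add[OF lin1(2) lin2(2)] sub[OF H]]
            integral_add[OF lin1(2) lin2(2)] lin1(1) lin2(1))
      also have "\<dots> = integral {a..b} (\<lambda>s. prod (f' s) (g b - g s) + prod (f a - f s) (g' s))"
        by (intro integral_cong) (simp add: P.diff_left P.diff_right)
      finally have eq: "G b - G a = integral {a..b} (\<lambda>s. prod (f' s) (g b - g s) + prod (f a - f s) (g' s))" .
      have "norm (integral {a..b} (\<lambda>s. prod (f' s) (g b - g s) + prod (f a - f s) (g' s)))
            \<le> integral {a..b} (\<lambda>s. e * ?v s)"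
      proof (rule integral_norm_bound_integral)
        have "(\<lambda>s. (prod (f' s) (g b) + prod (f a) (g' s)) - ?H s) integrable_on {a..b}"
          by (rule integrable_diff[OF integrable_add[OF lin1(2) lin2(2)] sub[OF H]])
        thus "(\<lambda>s. prod (f' s) (g b - g s) + prod (f a - f s) (g' s)) integrable_on {a..b}"
          by (simp add: P.diff_left P.diff_right algebra_simps)
        show "(\<lambda>s. e * ?v s) integrable_on {a..b}"
          using sub[OF v] by (rule integrable_on_mult_right)
        fix s assume s: "s \<in> {a..b}"
        have "dist (g b) (g s) < e'" "dist (f a) (f s) < e'"
          using d1(2)[of s a] d2(2)[of s b] s ab by (auto simp: dist_real_def)
        hence *: "norm (g b - g s) \<le> e'" "norm (f a - f s) \<le> e'" by (auto simp: dist_norm)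
        have "norm (prod (f' s) (g b - g s) + prod (f a - f s) (g' s))
            \<le> norm (f' s) * norm (g b - g s) * K + norm (f a - f s) * norm (g' s) * K"
          using K(2)[of "f' s" "g b - g s"] K(2)[of "f a - f s" "g' s"] norm_triangle_ineq
          by (smt (verit, best))
        also have "\<dots> \<le> norm (f' s) * e' * K + e' * norm (g' s) * K"
          using * K(1) by (intro add_mono mult_right_mono mult_left_mono) auto
        also have "\<dots> = e * ?v s" using K(1) by (simp add: e'_def field_simps)
        finally show "norm (prod (f' s) (g b - g s) + prod (f a - f s) (g' s)) \<le> e * ?v s" .
      qed
      also have "\<dots> = e * (V b - V a)"
        unfolding V_def using split[OF v ab(1-3)] by simp
      finally show ?thesis using eq by simp
    qed
    thus "\<exists>d>0. \<forall>a b. 0 \<le> a \<and> a \<le> b \<and> b \<le> T \<and> b - a < d \<longrightarrow> norm (G b - G a) \<le> e * (V b - V a)"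
      using d1(1) d2(1) by (intro exI[of _ "min d1 d2"]) auto
  qed
  thus ?thesis by (simp add: G_def algebra_simps)
qed

text \<open>
  Over the simplex this is the \<open>(k + 1)\<close>-fold integral of a product: the source of the factorials.
  Since \<open>U\<close> is not differentiable everywhere, the power rule is proved by induction, integrating the product
  \<open>U\<^sup>k\<^sup>+\<^sup>1 U\<close> by parts.
\<close>

lemma integral_power_of_integral:
  fixes \<rho> :: "real \<Rightarrow> real"
  assumes "0 \<le> T" and \<rho>: "\<rho> absolutely_integrable_on {0..T}"
  defines "U \<equiv> \<lambda>t. integral {0..t} \<rho>"
  shows "integral {0..T} (\<lambda>s. \<rho> s * (U s ^ k / fact k)) = U T ^ Suc k / fact (Suc k)"
proof -
  have cont: "continuous_on {0..T} U"
    unfolding U_def using \<rho> by (intro indefinite_integral_continuous_1) (simp add: absolutely_integrable_on_def)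
  have "integral {0..t} (\<lambda>s. real (Suc k) * (\<rho> s * U s ^ k)) = U t ^ Suc k" if "t \<in> {0..T}" for t
    using that
  proof (induction k arbitrary: t)
    case 0
    show ?case by (simp add: U_def)
  next
    case (Suc k)
    have sub: "\<rho> absolutely_integrable_on {0..t}"
      using set_integrable_subset[OF \<rho>] Suc.prems by auto
    have "continuous_on {0..t} U" using cont Suc.prems by (auto intro: continuous_on_subset)
    hence f': "(\<lambda>s. real (Suc k) * (\<rho> s * U s ^ k)) absolutely_integrable_on {0..t}"
      using sub by (intro set_integrable_mult_right
          absolutely_integrable_bilinear_continuous[OF bounded_bilinear_mult] continuous_intros)
    have "integral {0..t} (\<lambda>s. real (Suc k) * (\<rho> s * U s ^ k) * U s + U s ^ Suc k * \<rho> s)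
          = U t ^ Suc k * U t - U 0 ^ Suc k * U 0"
    proof (rule integral_by_parts_absolutely_continuous[OF bounded_bilinear_mult _ f' sub])
      fix s assume "s \<in> {0..t}"
      thus "U s ^ Suc k = U 0 ^ Suc k + integral {0..s} (\<lambda>s. real (Suc k) * (\<rho> s * U s ^ k))"
        using Suc.IH[of s] Suc.prems by (simp add: U_def)
    qed (use Suc.prems in \<open>auto simp: U_def\<close>)
    also have "\<dots> = U t ^ Suc (Suc k)" by (simp add: U_def)
    also have "(\<lambda>s. real (Suc k) * (\<rho> s * U s ^ k) * U s + U s ^ Suc k * \<rho> s)
        = (\<lambda>s. real (Suc (Suc k)) * (\<rho> s * U s ^ Suc k))"
      by (auto simp: algebra_simps)
    finally show ?case .
  qed
  from this[of T] assms(1) have "real (Suc k) * integral {0..T} (\<lambda>s. \<rho> s * U s ^ k) = U T ^ Suc k"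
    by simp
  moreover have "integral {0..T} (\<lambda>s. \<rho> s * (U s ^ k / fact k)) = integral {0..T} (\<lambda>s. \<rho> s * U s ^ k) / fact k"
    by (simp flip: integral_divide)
  ultimately have "real (Suc k) * (integral {0..T} (\<lambda>s. \<rho> s * (U s ^ k / fact k)) * fact k) = U T ^ Suc k"
    by (simp del: of_nat_Suc power_Suc)
  thus ?thesis
    by (simp add: eq_divide_eq fact_Suc mult.assoc mult.left_commute mult.commute del: of_nat_Suc power_Suc)
qed

section \<open>Cauchy-Schwarz inequalities for extended nonnegative integrals\<close>

lemma power2_norm_vec: "(norm (v :: real^'a))\<^sup>2 = (\<Sum>k\<in>UNIV. (v $ k)\<^sup>2)"
  unfolding power2_norm_eq_inner by (simp add: inner_vec_def power2_eq_square)

text \<open>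
  The inequality of arithmetic and geometric means for \<open>l * a\<close> and \<open>b / l\<close>; it is linear in
  \<open>a\<close> and \<open>b\<close>, hence can be integrated.
\<close>

lemma ennreal_le_weighted_mean:
  fixes F a b :: ennreal
  assumes "F\<^sup>2 \<le> a * b" and l: "l > 0"
  shows "F \<le> (ennreal l * a + ennreal (1 / l) * b) / 2"
proof (cases "a = top \<or> b = top")
  case True
  show ?thesis
  proof -
    have "ennreal l * a + ennreal (1 / l) * b = top"
      using True l by (auto simp: ennreal_mult_top)
    hence "(ennreal l * a + ennreal (1 / l) * b) / 2 = top" by (simp only:) (simp add: ennreal_top_divide)
    thus ?thesis by (simp only: top_greatest)
  qed
next
  case False
  then obtain a' b' where ab: "a = ennreal a'" "b = ennreal b'" "0 \<le> a'" "0 \<le> b'"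
    by (metis ennreal_cases)
  have "F \<noteq> top"
    using assms(1) ab by (auto simp: ennreal_mult[symmetric] top_unique power2_eq_square)
  then obtain f where f: "F = ennreal f" "0 \<le> f" by (metis ennreal_cases)
  have "f\<^sup>2 \<le> a' * b'"
    using assms(1) ab f by (simp add: ennreal_mult[symmetric] ennreal_power)
  also have "\<dots> \<le> ((l * a' + 1 / l * b') / 2)\<^sup>2"
  proof -
    have "0 \<le> (l * a' - 1 / l * b')\<^sup>2" by simp
    thus ?thesis using l by (simp add: power2_eq_square field_simps)
  qed
  finally have "f \<le> (l * a' + 1 / l * b') / 2"
    by (rule power2_le_imp_le) (use l ab in simp)
  thus ?thesis using l ab f
    by (simp add: ennreal_mult[symmetric] ennreal_plus[symmetric] ennreal_divide_numeral del: ennreal_plus)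
qed

text \<open>
  Integrate the weighted mean of \<open>a\<close> and \<open>b\<close> and choose the weight that balances the two integrals.
  The form with a pointwise hypothesis \<open>F\<^sup>2 \<le> a b\<close> avoids square roots of infinite values. When one
  integral vanishes, so does \<open>F\<close> almost everywhere, in accordance with \<open>0 * \<infinity> = 0\<close>.
\<close>

lemma nn_integral_Cauchy_Schwarz:
  fixes F a b :: "'a \<Rightarrow> ennreal"
  assumes [measurable]: "F \<in> borel_measurable M" "a \<in> borel_measurable M" "b \<in> borel_measurable M"
    and le: "AE s in M. (F s)\<^sup>2 \<le> a s * b s"
  shows "(\<integral>\<^sup>+s. F s \<partial>M)\<^sup>2 \<le> (\<integral>\<^sup>+s. a s \<partial>M) * (\<integral>\<^sup>+s. b s \<partial>M)"
proof -
  let ?I = "\<lambda>f. \<integral>\<^sup>+s. f s \<partial>M"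
  have zero: "?I F = 0" if "?I a = 0 \<or> ?I b = 0"
  proof -
    have "(AE s in M. a s = 0) \<or> (AE s in M. b s = 0)"
      using that by (simp add: nn_integral_0_iff_AE)
    hence "AE s in M. F s = 0"
      using le by (auto elim!: eventually_elim2)
    thus ?thesis by (simp add: nn_integral_0_iff_AE)
  qed
  consider "?I a = 0 \<or> ?I b = 0" | "?I a \<noteq> 0" "?I b \<noteq> 0" "?I a = top \<or> ?I b = top"
    | "?I a \<noteq> 0" "?I b \<noteq> 0" "?I a \<noteq> top" "?I b \<noteq> top" by blast
  thus ?thesis
  proof cases
    case 1
    thus ?thesis using zero by simp
  next
    case 2
    thus ?thesis by (auto simp: ennreal_mult_top ennreal_top_mult)
  next
    case 3
    then obtain \<alpha> \<beta> where ab: "?I a = ennreal \<alpha>" "?I b = ennreal \<beta>" "\<alpha> > 0" "\<beta> > 0"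
      by (metis ennreal_cases ennreal_0 le_less)
    \<comment> \<open>For this weight both terms of the mean have the same integral.\<close>
    define l where "l = sqrt (\<beta> / \<alpha>)"
    have l: "l > 0" using ab by (simp add: l_def)
    have "?I F \<le> (\<integral>\<^sup>+s. (ennreal l * a s + ennreal (1 / l) * b s) / 2 \<partial>M)"
      using le by (intro nn_integral_mono_AE) (auto elim!: eventually_mono intro: ennreal_le_weighted_mean l)
    also have "\<dots> = (ennreal l * ?I a + ennreal (1 / l) * ?I b) / 2"
      by (simp add: nn_integral_divide nn_integral_add nn_integral_cmult)
    also have "\<dots> = ennreal ((l * \<alpha> + 1 / l * \<beta>) / 2)"
      using ab l by (simp add: ennreal_mult[symmetric] ennreal_plus[symmetric] ennreal_divide_numeral del: ennreal_plus)
    also have "(l * \<alpha> + 1 / l * \<beta>) / 2 = sqrt (\<alpha> * \<beta>)"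
      using ab by (simp add: l_def real_sqrt_divide real_sqrt_mult field_simps)
    finally have "(?I F)\<^sup>2 \<le> (ennreal (sqrt (\<alpha> * \<beta>)))\<^sup>2"
      by (intro power_mono) auto
    also have "\<dots> = ?I a * ?I b"
      using ab by (simp add: ennreal_power ennreal_mult[symmetric])
    finally show ?thesis .
  qed
qed

lemma sum_Cauchy_Schwarz_ennreal:
  fixes F a b :: "'i \<Rightarrow> ennreal"
  assumes "finite I" "\<And>i. i \<in> I \<Longrightarrow> (F i)\<^sup>2 \<le> a i * b i"
  shows "(\<Sum>i\<in>I. F i)\<^sup>2 \<le> (\<Sum>i\<in>I. a i) * (\<Sum>i\<in>I. b i)"
  using nn_integral_Cauchy_Schwarz[of F "count_space I" a b] assms
  by (simp add: nn_integral_count_space_finite AE_count_space)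

text \<open>
  The factor \<open>\<beta>\<close> depends on the elapsed time \<open>t - s\<close> only. Reflecting \<open>[0, t]\<close> and enlarging it
  to the half-line makes its integral independent of \<open>t\<close>.
\<close>

lemma convolution_Cauchy_Schwarz:
  fixes F \<alpha> :: "real \<Rightarrow> real" and \<beta> :: "real \<Rightarrow> ennreal"
  assumes F: "F absolutely_integrable_on {0..t}"
    and \<alpha>: "\<alpha> integrable_on {0..t}" "\<And>s. s \<in> {0..t} \<Longrightarrow> 0 \<le> \<alpha> s"
    and \<beta>[measurable]: "\<beta> \<in> borel_measurable borel"
    and le: "\<And>s. s \<in> {0..t} \<Longrightarrow> ennreal ((F s)\<^sup>2) \<le> ennreal (\<alpha> s) * \<beta> (t - s)"
  shows "ennreal ((integral {0..t} F)\<^sup>2) \<le>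
    ennreal (integral {0..t} \<alpha>) * (\<integral>\<^sup>+\<tau>. \<beta> \<tau> \<partial>restrict_space lborel {0..})"
proof -
  let ?i = "indicator {0..t} :: real \<Rightarrow> ennreal"
  have aF: "(\<lambda>s. \<bar>F s\<bar>) integrable_on {0..t}" "F integrable_on {0..t}"
    using F by (auto simp: absolutely_integrable_on_def)
  have nnF: "(\<integral>\<^sup>+s. ennreal \<bar>F s\<bar> * ?i s \<partial>lborel) = ennreal (integral {0..t} (\<lambda>s. \<bar>F s\<bar>))"
    using aF(1) by (intro nn_integral_has_integral_lebesgue') (auto simp: integrable_integral)
  have nna: "(\<integral>\<^sup>+s. ennreal (\<alpha> s) * ?i s \<partial>lborel) = ennreal (integral {0..t} \<alpha>)"
    using \<alpha> by (intro nn_integral_has_integral_lebesgue') (auto simp: integrable_integral)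
  have meas: "(\<lambda>s. ennreal (f s) * ?i s) \<in> borel_measurable lebesgue" if "f integrable_on {0..t}" for f
  proof -
    have "(\<lambda>s. ennreal (indicator {0..t} s *\<^sub>R f s)) \<in> borel_measurable lebesgue"
      using that has_integral_implies_lebesgue_measurable[of f _ "{0..t}"]
      by (auto simp: integrable_on_def)
    also have "(\<lambda>s. ennreal (indicator {0..t} s *\<^sub>R f s)) = (\<lambda>s. ennreal (f s) * ?i s)"
      by (auto simp: indicator_def)
    finally show ?thesis .
  qed
  have bmeas: "(\<lambda>s. \<beta> (t - s) * ?i s) \<in> borel_measurable borel" by measurable
  have "ennreal ((integral {0..t} F)\<^sup>2) \<le> (ennreal (integral {0..t} (\<lambda>s. \<bar>F s\<bar>)))\<^sup>2"
  proof -
    have "\<bar>integral {0..t} F\<bar> \<le> integral {0..t} (\<lambda>s. \<bar>F s\<bar>)"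
      using integral_norm_bound_integral[OF aF(2,1)] by simp
    hence "(integral {0..t} F)\<^sup>2 \<le> (integral {0..t} (\<lambda>s. \<bar>F s\<bar>))\<^sup>2"
      by (metis abs_ge_zero power2_abs power_mono)
    thus ?thesis by (simp add: ennreal_power integral_nonneg aF ennreal_leI)
  qed
  also have "\<dots> = (\<integral>\<^sup>+s. ennreal \<bar>F s\<bar> * ?i s \<partial>lebesgue)\<^sup>2"
    by (simp add: nnF nn_integral_completion)
  also have "\<dots> \<le> (\<integral>\<^sup>+s. ennreal (\<alpha> s) * ?i s \<partial>lebesgue) * (\<integral>\<^sup>+s. \<beta> (t - s) * ?i s \<partial>lebesgue)"
  proof (rule nn_integral_Cauchy_Schwarz)
    show "AE s in lebesgue. (ennreal \<bar>F s\<bar> * ?i s)\<^sup>2 \<le> (ennreal (\<alpha> s) * ?i s) * (\<beta> (t - s) * ?i s)"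
      using le by (intro AE_I2) (auto simp: indicator_def ennreal_power)
  qed (use aF \<alpha> bmeas in \<open>auto intro: meas measurable_completion\<close>)
  also have "(\<integral>\<^sup>+s. ennreal (\<alpha> s) * ?i s \<partial>lebesgue) = ennreal (integral {0..t} \<alpha>)"
    by (simp add: nna nn_integral_completion)
  also have "(\<integral>\<^sup>+s. \<beta> (t - s) * ?i s \<partial>lebesgue) = (\<integral>\<^sup>+s. \<beta> (t - s) * ?i s \<partial>lborel)"
    by (rule nn_integral_completion)
  also have "\<dots> = (\<integral>\<^sup>+\<tau>. \<beta> \<tau> * ?i (t - \<tau>) \<partial>lborel)"
    using nn_integral_real_affine[of "\<lambda>s. \<beta> (t - s) * ?i s" "-1" t] by simp
  also have "\<dots> \<le> (\<integral>\<^sup>+\<tau>. \<beta> \<tau> * indicator {0..} \<tau> \<partial>lborel)"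
    by (intro nn_integral_mono) (auto simp: indicator_def)
  also have "\<dots> = (\<integral>\<^sup>+\<tau>. \<beta> \<tau> \<partial>restrict_space lborel {0..})"
    by (subst nn_integral_restrict_space) auto
  finally show ?thesis by (simp add: mult_left_mono)
qed

section \<open>The exponential of a matrix as a function of time\<close>

lemma matrix_matrix_add_rdistrib:
  fixes A B :: "real^'b^'a" and C :: "real^'c^'b"
  shows "(A + B) ** C = A ** C + B ** C"
  by (simp add: matrix_matrix_mult_def vec_eq_iff algebra_simps sum.distrib)

lemma bounded_bilinear_matrix_matrix_mult:
  "bounded_bilinear ((**) :: real^'b^'a \<Rightarrow> real^'c^'b \<Rightarrow> real^'c^'a)"
proof -
  have "bilinear ((**) :: real^'b^'a \<Rightarrow> real^'c^'b \<Rightarrow> real^'c^'a)"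
    unfolding bilinear_def
    by (auto intro!: linearI simp: matrix_add_ldistrib matrix_matrix_add_rdistrib matrix_scalar_ac scalar_matrix_assoc[symmetric])
  thus ?thesis by (simp add: bilinear_conv_bounded_bilinear)
qed

lemma bounded_bilinear_matrix_vector_mult:
  "bounded_bilinear ((*v) :: real^'b^'a \<Rightarrow> real^'b \<Rightarrow> real^'a)"
proof -
  have "bilinear ((*v) :: real^'b^'a \<Rightarrow> real^'b \<Rightarrow> real^'a)"
    unfolding bilinear_def
    by (auto intro!: linearI simp: algebra_simps scaleR_matrix_vector_assoc)
  thus ?thesis by (simp add: bilinear_conv_bounded_bilinear)
qed

definition mat_pow :: "real^'n^'n \<Rightarrow> nat \<Rightarrow> real^'n^'n" where
  "mat_pow A k = ((\<lambda>X. A ** X) ^^ k) (mat 1)"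

lemma mat_pow_simps [simp]: "mat_pow A 0 = mat 1" "mat_pow A (Suc k) = A ** mat_pow A k"
  by (simp_all add: mat_pow_def)

lemma mat_pow_commute: "mat_pow A k ** A = A ** mat_pow A k"
  by (induction k) (simp_all add: matrix_mul_assoc[symmetric])

lemma mat_pow_scaleR: "mat_pow (t *\<^sub>R A) k = t ^ k *\<^sub>R mat_pow A k"
  by (induction k) (simp_all add: matrix_scalar_ac scalar_matrix_assoc[symmetric] scaleR_left_commute)

lemma mat_pow_entry_le:
  "\<bar>mat_pow A k $ i $ j\<bar> \<le> (\<Sum>p\<in>UNIV. \<Sum>q\<in>UNIV. \<bar>A $ p $ q\<bar>) ^ k"
proof (induction k arbitrary: i)
  case 0
  show ?case by (simp add: mat_def)
next
  case (Suc k)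
  let ?K = "\<Sum>p\<in>UNIV. \<Sum>q\<in>UNIV. \<bar>A $ p $ q\<bar>"
  have "\<bar>mat_pow A (Suc k) $ i $ j\<bar> \<le> (\<Sum>q\<in>UNIV. \<bar>A $ i $ q\<bar> * \<bar>mat_pow A k $ q $ j\<bar>)"
    using sum_abs[of "\<lambda>q. A $ i $ q * mat_pow A k $ q $ j" UNIV] by (simp add: matrix_matrix_mult_def abs_mult)
  also have "\<dots> \<le> (\<Sum>q\<in>UNIV. \<bar>A $ i $ q\<bar> * ?K ^ k)"
    by (intro sum_mono mult_left_mono Suc.IH) auto
  also have "\<dots> = (\<Sum>q\<in>UNIV. \<bar>A $ i $ q\<bar>) * ?K ^ k"
    by (simp add: sum_distrib_right)
  also have "\<dots> \<le> ?K * ?K ^ k"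
  proof (rule mult_right_mono)
    show "(\<Sum>q\<in>UNIV. \<bar>A $ i $ q\<bar>) \<le> ?K"
      by (rule member_le_sum[of i UNIV "\<lambda>p. \<Sum>q\<in>UNIV. \<bar>A $ p $ q\<bar>"]) (auto intro: sum_nonneg)
  qed (auto intro!: zero_le_power sum_nonneg)
  finally show ?case by simp
qed

definition exp_at :: "real^'n^'n \<Rightarrow> real \<Rightarrow> real^'n^'n" where
  "exp_at A t = mat_exp (t *\<^sub>R A)"

lemma summable_exp_at_entry: "summable (\<lambda>k. (mat_pow A k $ i $ j / fact k) * t ^ k)"
proof (rule summable_comparison_test')
  let ?K = "\<Sum>p\<in>UNIV. \<Sum>q\<in>UNIV. \<bar>A $ p $ q\<bar>"
  show "summable (\<lambda>k. inverse (fact k) * (?K * \<bar>t\<bar>) ^ k)"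
    by (rule summable_exp)
  show "norm ((mat_pow A k $ i $ j / fact k) * t ^ k) \<le> inverse (fact k) * (?K * \<bar>t\<bar>) ^ k" for k
    using mult_right_mono[OF mat_pow_entry_le[of A k i j], of "\<bar>t\<bar> ^ k / fact k"]
    by (simp add: abs_mult power_abs power_mult_distrib field_simps)
qed

lemma exp_at_sums: "(\<lambda>k. (t ^ k / fact k) *\<^sub>R mat_pow A k) sums exp_at A t"
proof -
  let ?f = "\<lambda>k. (t ^ k / fact k) *\<^sub>R mat_pow A k"
  have "?f sums (\<chi> i j. \<Sum>k. (mat_pow A k $ i $ j / fact k) * t ^ k)"
    unfolding sums_def
  proof (intro vec_tendstoI)
    fix i j
    have "(\<lambda>n. \<Sum>k<n. (mat_pow A k $ i $ j / fact k) * t ^ k) \<longlonglongrightarrow> (\<Sum>k. (mat_pow A k $ i $ j / fact k) * t ^ k)"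
      by (rule summable_LIMSEQ[OF summable_exp_at_entry])
    thus "(\<lambda>n. sum ?f {..<n} $ i $ j) \<longlonglongrightarrow> (\<chi> i j. \<Sum>k. (mat_pow A k $ i $ j / fact k) * t ^ k) $ i $ j"
      by (simp add: mult.commute)
  qed
  moreover have "exp_at A t = suminf ?f"
    by (simp add: exp_at_def mat_exp_def mat_pow_def[symmetric] mat_pow_scaleR)
  ultimately show ?thesis by (simp add: sums_iff)
qed

lemma exp_at_entry: "exp_at A t $ i $ j = (\<Sum>k. (mat_pow A k $ i $ j / fact k) * t ^ k)"
  using sums_unique[OF sums_vec_nth[OF sums_vec_nth[OF exp_at_sums[of t A], of i], of j]]
  by (simp add: mult.commute)

lemma exp_at_0 [simp]: "exp_at A 0 = mat 1"
proof -
  have "(\<lambda>k. (0 ^ k / fact k) *\<^sub>R mat_pow A k) sums ((0 ^ 0 / fact 0) *\<^sub>R mat_pow A 0)"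
    using sums_finite[of "{0}" "\<lambda>k. (0 ^ k / fact k) *\<^sub>R mat_pow A k"] by simp
  from sums_unique2[OF exp_at_sums this] show ?thesis by simp
qed

lemma exp_at_commute: "exp_at A t ** A = A ** exp_at A t"
proof -
  have "(\<lambda>k. A ** ((t ^ k / fact k) *\<^sub>R mat_pow A k)) sums (A ** exp_at A t)"
    "(\<lambda>k. ((t ^ k / fact k) *\<^sub>R mat_pow A k) ** A) sums (exp_at A t ** A)"
    by (intro bounded_linear.sums[OF bounded_bilinear.bounded_linear_right[OF bounded_bilinear_matrix_matrix_mult]] exp_at_sums
          bounded_linear.sums[OF bounded_bilinear.bounded_linear_left[OF bounded_bilinear_matrix_matrix_mult]])+
  thus ?thesis
    using sums_unique2 by (simp add: matrix_scalar_ac scalar_matrix_assoc[symmetric] mat_pow_commute)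
qed

text \<open>
  Each entry is a power series in \<open>t\<close> that converges everywhere, so it can be differentiated term by term.
\<close>

lemma exp_at_has_vector_derivative: "(exp_at A has_vector_derivative (A ** exp_at A t)) (at t within S)"
proof -
  have "((\<lambda>t. exp_at A t $ i $ j) has_field_derivative (A ** exp_at A t) $ i $ j) (at t)" for i j
  proof -
    let ?c = "\<lambda>k. mat_pow A k $ i $ j / fact k"
    have "((\<lambda>t. \<Sum>k. ?c k * t ^ k) has_field_derivative (\<Sum>k. diffs ?c k * t ^ k)) (at t)"
      by (rule termdiffs_strong_converges_everywhere) (rule summable_exp_at_entry)
    moreover have "diffs ?c k * t ^ k = (A ** ((t ^ k / fact k) *\<^sub>R mat_pow A k)) $ i $ j" for k
      by (simp add: diffs_def matrix_scalar_ac scalar_matrix_assoc[symmetric] del: of_nat_Suc)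
    moreover have "(\<lambda>k. (A ** ((t ^ k / fact k) *\<^sub>R mat_pow A k)) $ i $ j) sums (A ** exp_at A t) $ i $ j"
      by (intro sums_vec_nth exp_at_sums
          bounded_linear.sums[OF bounded_bilinear.bounded_linear_right[OF bounded_bilinear_matrix_matrix_mult]])
    moreover have "(\<lambda>t. \<Sum>k. ?c k * t ^ k) = (\<lambda>t. exp_at A t $ i $ j)"
      by (simp only: exp_at_entry)
    ultimately show ?thesis by (simp only: sums_iff)
  qed
  hence entry: "((\<lambda>t. exp_at A t $ i $ j) has_derivative (\<lambda>h. (h *\<^sub>R (A ** exp_at A t)) $ i $ j)) (at t within S)" for i j
    by (auto simp: has_field_derivative_def mult.commute[of _ "_ $ _ $ _"] intro: has_derivative_at_withinI)
  show ?thesis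
    unfolding has_vector_derivative_def
  proof (subst has_derivative_componentwise_within, intro ballI)
    fix b :: "real^'a^'a" assume "b \<in> Basis"
    then obtain i j where "b = axis i (axis j 1)"
      by (auto simp: Basis_vec_def)
    thus "((\<lambda>x. exp_at A x \<bullet> b) has_derivative (\<lambda>x. (x *\<^sub>R (A ** exp_at A t)) \<bullet> b)) (at t within S)"
      using entry[of i j] by (simp add: inner_axis)
  qed
qed

lemma continuous_on_exp_at: "continuous_on S (exp_at A)"
  by (metis continuous_on_eq_continuous_within exp_at_has_vector_derivative has_vector_derivative_continuous)

text \<open>
  The function \<open>r \<mapsto> e\<^bsup>A (s + t - r)\<^esup> e\<^bsup>A r\<^esup>\<close> has derivative zero; compare its values at \<open>t\<close> and
  \<open>0\<close>.
\<close>

lemma exp_at_add: "exp_at A s ** exp_at A t = exp_at A (s + t)"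
proof -
  let ?G = "\<lambda>r. exp_at A (s + t - r) ** exp_at A r"
  have deriv: "(?G has_derivative (\<lambda>h. 0)) (at r within UNIV)" for r
  proof -
    have "((\<lambda>r. exp_at A (s + t - r)) has_vector_derivative (- 1) *\<^sub>R (A ** exp_at A (s + t - r))) (at r within UNIV)"
    proof -
      have "((\<lambda>r. s + t - r) has_vector_derivative - 1) (at r within UNIV)"
        by (auto intro!: derivative_eq_intros)
      from vector_diff_chain_within[OF this exp_at_has_vector_derivative] show ?thesis
        by (simp add: o_def)
    qed
    from bounded_bilinear.has_vector_derivative[OF bounded_bilinear_matrix_matrix_mult this
        exp_at_has_vector_derivative[of A r UNIV]]
    have "(?G has_vector_derivative
        (exp_at A (s + t - r) ** (A ** exp_at A r) + ((- 1) *\<^sub>R (A ** exp_at A (s + t - r))) ** exp_at A r)) (at r within UNIV)" .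
    moreover have "exp_at A (s + t - r) ** (A ** exp_at A r) + ((- 1) *\<^sub>R (A ** exp_at A (s + t - r))) ** exp_at A r = 0"
      by (simp only: matrix_mul_assoc exp_at_commute scalar_matrix_assoc[symmetric]) simp
    ultimately show ?thesis by (simp add: has_vector_derivative_def)
  qed
  have "?G t = ?G 0"
    by (rule has_derivative_zero_unique[OF convex_UNIV deriv]) auto
  thus ?thesis by simp
qed

section \<open>Responses of a linear system\<close>

text \<open>
  The solution of \<open>z' = A z + h\<close>, \<open>z 0 = 0\<close>. With \<open>e\<^bsup>A t\<^esup>\<close> in front of the integral, it is plain
  that it is continuous in \<open>t\<close>.
\<close>

definition response :: "real^'n^'n \<Rightarrow> (real \<Rightarrow> real^'n) \<Rightarrow> real \<Rightarrow> real^'n" where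
  "response A h t = exp_at A t *v integral {0..t} (\<lambda>s. exp_at A (- s) *v h s)"

lemma continuous_on_exp_at_comp: "continuous_on S f \<Longrightarrow> continuous_on S (\<lambda>s. exp_at A (f s))"
  by (rule continuous_on_compose2[OF continuous_on_exp_at[of UNIV]]) auto

lemma absolutely_integrable_exp_at_mult:
  assumes "h absolutely_integrable_on {0..t::real}" "continuous_on {0..t} f"
  shows "(\<lambda>s. exp_at A (f s) *v h s) absolutely_integrable_on {0..t}"
  by (rule absolutely_integrable_continuous_bilinear[OF bounded_bilinear_matrix_vector_mult
        continuous_on_exp_at_comp[OF assms(2)] assms(1)])

lemma integrable_exp_at_mult:
  assumes "h absolutely_integrable_on {0..t::real}"
  shows "(\<lambda>s. exp_at A (- s) *v h s) integrable_on {0..t}" "(\<lambda>s. exp_at A (t - s) *v h s) integrable_on {0..t}"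
proof -
  have "continuous_on {0..t} (\<lambda>s. - s)" "continuous_on {0..t} (\<lambda>s. t - s)"
    by (intro continuous_intros)+
  from this[THEN absolutely_integrable_exp_at_mult[OF assms]]
  show "(\<lambda>s. exp_at A (- s) *v h s) integrable_on {0..t}" "(\<lambda>s. exp_at A (t - s) *v h s) integrable_on {0..t}"
    by (simp_all add: absolutely_integrable_on_def)
qed

lemma continuous_on_response:
  assumes "h absolutely_integrable_on {0..T}"
  shows "continuous_on {0..T} (response A h)"
proof -
  have "(\<lambda>s. exp_at A (- s) *v h s) integrable_on {0..T}"
    by (rule integrable_exp_at_mult[OF assms])
  from indefinite_integral_continuous_1[OF this] show ?thesis
    unfolding response_def
    by (intro bounded_bilinear.continuous_on[OF bounded_bilinear_matrix_vector_mult] continuous_on_exp_at)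
qed

lemma response_eq_convolution:
  assumes "h absolutely_integrable_on {0..t}"
  shows "response A h t = integral {0..t} (\<lambda>s. exp_at A (t - s) *v h s)"
proof -
  have "(\<lambda>s. exp_at A (- s) *v h s) integrable_on {0..t}"
    by (rule integrable_exp_at_mult[OF assms])
  from integral_linear[OF this matrix_vector_mul_bounded_linear[of "exp_at A t"]]
  show ?thesis
    by (simp add: response_def o_def matrix_vector_mul_assoc exp_at_add)
qed

lemma inner_response:
  assumes "h absolutely_integrable_on {0..t}"
  shows "v \<bullet> response A h t = integral {0..t} (\<lambda>s. (transpose (exp_at A (t - s)) *v v) \<bullet> h s)"
    and "(\<lambda>s. (transpose (exp_at A (t - s)) *v v) \<bullet> h s) absolutely_integrable_on {0..t}"
proof -
  have ai: "(\<lambda>s. exp_at A (t - s) *v h s) absolutely_integrable_on {0..t}"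
    by (intro absolutely_integrable_exp_at_mult assms continuous_intros)
  have eq: "v \<bullet> (exp_at A (t - s) *v h s) = (transpose (exp_at A (t - s)) *v v) \<bullet> h s" for s
    by (metis dot_lmul_matrix transpose_matrix_vector)
  have "(\<lambda>s. exp_at A (t - s) *v h s) integrable_on {0..t}"
    using ai by (simp add: absolutely_integrable_on_def)
  from integral_linear[OF this bounded_linear_inner_right[of v]]
  show "v \<bullet> response A h t = integral {0..t} (\<lambda>s. (transpose (exp_at A (t - s)) *v v) \<bullet> h s)"
    by (simp add: response_eq_convolution[OF assms] o_def eq)
  from absolutely_integrable_linear[OF ai bounded_linear_inner_right[of v]]
  show "(\<lambda>s. (transpose (exp_at A (t - s)) *v v) \<bullet> h s) absolutely_integrable_on {0..t}"
    by (simp add: o_def eq)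
qed

lemma response_add:
  assumes "h absolutely_integrable_on {0..t}" "k absolutely_integrable_on {0..t}"
  shows "response A (\<lambda>s. h s + k s) t = response A h t + response A k t"
proof -
  have "(\<lambda>s. exp_at A (- s) *v h s) integrable_on {0..t}" "(\<lambda>s. exp_at A (- s) *v k s) integrable_on {0..t}"
    by (simp_all add: integrable_exp_at_mult assms)
  thus ?thesis
    by (simp add: response_def matrix_vector_right_distrib integral_add)
qed

lemma response_norm_le:
  fixes A :: "real^'n^'n" and T :: real
  obtains L where "L > 0" "\<And>t h. t \<in> {0..T} \<Longrightarrow> h absolutely_integrable_on {0..t} \<Longrightarrow>
      norm (response A h t) \<le> L * integral {0..t} (\<lambda>s. norm (h s))"
proof -
  obtain K where K: "K > 0" "\<And>X x. norm (X *v x) \<le> norm (X :: real^'n^'n) * norm (x :: real^'n) * K"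
    using bounded_bilinear.pos_bounded[OF bounded_bilinear_matrix_vector_mult] by blast
  have "bounded (exp_at A ` {0..T})"
    by (intro compact_imp_bounded compact_continuous_image continuous_on_exp_at) auto
  then obtain E where E: "E > 0" "\<And>t. t \<in> {0..T} \<Longrightarrow> norm (exp_at A t) \<le> E"
    unfolding bounded_pos by auto
  show ?thesis
  proof (rule that[of "E * K"])
    show "E * K > 0" using E K by simp
    fix t and h :: "real \<Rightarrow> real^'n" assume t: "t \<in> {0..T}" and h: "h absolutely_integrable_on {0..t}"
    have "norm (response A h t) \<le> integral {0..t} (\<lambda>s. (E * K) * norm (h s))"
      unfolding response_eq_convolution[OF h]
    proof (rule integral_norm_bound_integral)
      show "(\<lambda>s. exp_at A (t - s) *v h s) integrable_on {0..t}"
        by (rule integrable_exp_at_mult[OF h])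
      show "(\<lambda>s. (E * K) * norm (h s)) integrable_on {0..t}"
        using h unfolding absolutely_integrable_on_def by (intro integrable_on_mult_right) auto
      fix s assume "s \<in> {0..t}"
      hence "norm (exp_at A (t - s)) \<le> E" using t by (intro E(2)) auto
      hence "norm (exp_at A (t - s)) * norm (h s) * K \<le> E * norm (h s) * K"
        using K by (intro mult_right_mono) auto
      thus "norm (exp_at A (t - s) *v h s) \<le> (E * K) * norm (h s)"
        using K(2)[of "exp_at A (t - s)" "h s"] by (simp add: algebra_simps)
    qed
    thus "norm (response A h t) \<le> E * K * integral {0..t} (\<lambda>s. norm (h s))" by simp
  qed
qed

text \<open>
  Integrate by parts the product of \<open>e\<^bsup>- A s\<^esup>\<close> and \<open>x s\<close>: the terms with \<open>A\<close> cancel.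
\<close>

lemma variation_of_constants:
  fixes x h :: "real \<Rightarrow> real^'n"
  assumes T: "0 \<le> T" and h: "h absolutely_integrable_on {0..T}"
    and g: "(\<lambda>s. A *v x s + h s) absolutely_integrable_on {0..T}"
    and x: "\<And>t. t \<in> {0..T} \<Longrightarrow> x t = integral {0..t} (\<lambda>s. A *v x s + h s)"
  shows "x T = response A h T"
proof -
  let ?f' = "\<lambda>s. - (A ** exp_at A (- s))"
  have deriv: "((\<lambda>s. exp_at A (- s)) has_vector_derivative ?f' s) (at s within S)" for s S
  proof -
    have "((\<lambda>s. - s) has_vector_derivative (- 1 :: real)) (at s within S)"
      by (auto intro!: derivative_eq_intros)
    from vector_diff_chain_within[OF this exp_at_has_vector_derivative] show ?thesis
      by (simp add: o_def)
  qed
  have f'c: "continuous_on {0..T} ?f'"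
    by (intro continuous_intros bounded_bilinear.continuous_on[OF bounded_bilinear_matrix_matrix_mult]
        continuous_on_exp_at_comp)
  have x0: "x 0 = 0" using x[of 0] T by simp
  have "integral {0..T} (\<lambda>s. ?f' s *v x s + exp_at A (- s) *v (A *v x s + h s))
      = exp_at A (- T) *v x T - exp_at A (- 0) *v x 0"
  proof (rule integral_by_parts_absolutely_continuous[OF bounded_bilinear_matrix_vector_mult T _ g])
    show "?f' absolutely_integrable_on {0..T}"
      by (rule absolutely_integrable_continuous_real[OF f'c])
    show "exp_at A (- t) = exp_at A (- 0) + integral {0..t} ?f'" if "t \<in> {0..T}" for t
      using integral_unique[OF fundamental_theorem_of_calculus[of 0 t "\<lambda>s. exp_at A (- s)" ?f']] deriv that
      by (simp add: algebra_simps)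
    show "x t = x 0 + integral {0..t} (\<lambda>s. A *v x s + h s)" if "t \<in> {0..T}" for t
      using x[OF that] x0 by simp
  qed
  also have "(\<lambda>s. ?f' s *v x s + exp_at A (- s) *v (A *v x s + h s)) = (\<lambda>s. exp_at A (- s) *v h s)"
  proof
    fix s
    have neg: "(- X) *v z = - (X *v z)" for X :: "real^'n^'n" and z
      by (simp add: bounded_bilinear.minus_left[OF bounded_bilinear_matrix_vector_mult])
    show "?f' s *v x s + exp_at A (- s) *v (A *v x s + h s) = exp_at A (- s) *v h s"
      by (simp add: neg matrix_vector_right_distrib matrix_vector_mul_assoc exp_at_commute)
  qed
  finally have "integral {0..T} (\<lambda>s. exp_at A (- s) *v h s) = exp_at A (- T) *v x T"
    using x0 by simp
  thus ?thesis
    by (simp add: response_def matrix_vector_mul_assoc exp_at_add)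
qed

section \<open>The Volterra series of the state\<close>

definition bilin :: "('m::finite \<Rightarrow> real^'n^'n) \<Rightarrow> real^'m \<Rightarrow> real^'n \<Rightarrow> real^'n" where
  "bilin N w z = (\<Sum>k\<in>UNIV. w $ k *\<^sub>R (N k *v z))"

lemma bounded_bilinear_bilin: "bounded_bilinear (bilin N)"
proof -
  have "bilinear (bilin N)"
    unfolding bilinear_def bilin_def
    by (auto intro!: linearI simp: algebra_simps sum.distrib scaleR_sum_right)
  thus ?thesis by (simp add: bilinear_conv_bounded_bilinear)
qed

primrec volterra ::
  "real^'n^'n \<Rightarrow> real^'m^'n \<Rightarrow> ('m \<Rightarrow> real^'n^'n) \<Rightarrow> (real \<Rightarrow> real^'m) \<Rightarrow> nat \<Rightarrow> real \<Rightarrow> real^'n" where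
  "volterra A B N u 0 = response A (\<lambda>s. B *v u s)"
| "volterra A B N u (Suc i) = response A (\<lambda>s. bilin N (u s) (volterra A B N u i s))"

context
  fixes A :: "real^'n^'n" and B :: "real^'m^'n" and N :: "'m \<Rightarrow> real^'n^'n"
    and u :: "real \<Rightarrow> real^'m"
  assumes u: "\<And>t. u absolutely_integrable_on {0..t}"
begin

lemma absolutely_integrable_input: "(\<lambda>s. B *v u s) absolutely_integrable_on {0..t}"
  using absolutely_integrable_linear[OF u[of t] matrix_vector_mul_bounded_linear[of B]] by (simp add: o_def)

lemma absolutely_integrable_bilin:
  "continuous_on {0..t} z \<Longrightarrow> (\<lambda>s. bilin N (u s) (z s)) absolutely_integrable_on {0..t}"
  by (rule absolutely_integrable_bilinear_continuous[OF bounded_bilinear_bilin u])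

lemma continuous_on_volterra: "continuous_on {0..t} (volterra A B N u i)"
  by (induction i arbitrary: t)
    (auto intro!: continuous_on_response absolutely_integrable_input absolutely_integrable_bilin)

lemma state_continuous:
  assumes "bqo_state A B N u x"
  shows "continuous_on {0..t} x"
proof (cases "0 \<le> t")
  case True
  have "(\<lambda>s. bqo_rhs A B N (u s) (x s)) integrable_on {0..t}"
    using assms True by (auto simp: bqo_state_def absolutely_integrable_on_def)
  note indefinite_integral_continuous_1[OF this]
  moreover have "x s = integral {0..s} (\<lambda>s. bqo_rhs A B N (u s) (x s))" if "s \<in> {0..t}" for s
    using assms that by (simp add: bqo_state_def)
  ultimately show ?thesis by (simp only: cong: continuous_on_cong)
qed simp

lemma state_eq_response:
  assumes x: "bqo_state A B N u x" and "0 \<le> t"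
  shows "x t = response A (\<lambda>s. bilin N (u s) (x s) + B *v u s) t"
proof (rule variation_of_constants[OF \<open>0 \<le> t\<close>])
  have eq: "A *v x s + (bilin N (u s) (x s) + B *v u s) = bqo_rhs A B N (u s) (x s)" for s
    by (simp add: bqo_rhs_def bilin_def algebra_simps)
  show "(\<lambda>s. bilin N (u s) (x s) + B *v u s) absolutely_integrable_on {0..t}"
    by (intro set_integral_add absolutely_integrable_bilin absolutely_integrable_input state_continuous[OF x])
  show "(\<lambda>s. A *v x s + (bilin N (u s) (x s) + B *v u s)) absolutely_integrable_on {0..t}"
    using x \<open>0 \<le> t\<close> by (simp add: eq bqo_state_def)
  show "x s = integral {0..s} (\<lambda>s. A *v x s + (bilin N (u s) (x s) + B *v u s))" if "s \<in> {0..t}" for s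
    using x that by (simp add: eq bqo_state_def)
qed

text \<open>
  By linearity of the response, the forcing of the tail of the series is produced by the previous
  tail.
\<close>

lemma volterra_remainder:
  assumes x: "bqo_state A B N u x" and "0 \<le> t"
  defines "R \<equiv> \<lambda>k t. x t - (\<Sum>i<k. volterra A B N u i t)"
  shows "R (Suc k) t = response A (\<lambda>s. bilin N (u s) (R k s)) t"
proof (induction k)
  case 0
  show ?case
    using response_add[OF absolutely_integrable_bilin[OF state_continuous[OF x]] absolutely_integrable_input]
    by (simp add: R_def state_eq_response[OF x \<open>0 \<le> t\<close>])
next
  case (Suc k)
  have cont: "continuous_on {0..t} (R k)" for k
    unfolding R_def by (intro continuous_intros continuous_on_volterra state_continuous[OF x])
  have "(\<lambda>s. bilin N (u s) (R k s)) = (\<lambda>s. bilin N (u s) (R (Suc k) s) + bilin N (u s) (volterra A B N u k s))"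
    by (simp add: R_def bounded_bilinear.add_right[OF bounded_bilinear_bilin, symmetric])
  hence "R (Suc k) t = response A (\<lambda>s. bilin N (u s) (R (Suc k) s)) t + volterra A B N u (Suc k) t"
    unfolding Suc
    by (simp add: response_add absolutely_integrable_bilin cont continuous_on_volterra)
  moreover have "R (Suc (Suc k)) t = R (Suc k) t - volterra A B N u (Suc k) t"
    by (simp add: R_def del: volterra.simps)
  ultimately show ?case by (simp del: volterra.simps)
qed

text \<open>
  On \<open>[0, t]\<close> the tail after \<open>k\<close> terms is the result of \<open>k\<close> iterations of a Volterra integral
  operator on \<open>x\<close>, hence at most \<open>X (L K)\<^sup>k V\<^sup>k / k!\<close>, where \<open>V = \<integral> |u|\<close> and \<open>X\<close>, \<open>L\<close>, \<open>K\<close>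
  are bounds for \<open>x\<close>, for the response and for the bilinear term.
\<close>

lemma volterra_series_converges:
  assumes x: "bqo_state A B N u x" and t: "0 \<le> t"
  shows "(\<lambda>k. \<Sum>i<k. volterra A B N u i t) \<longlonglongrightarrow> x t"
proof -
  define R where "R = (\<lambda>k t. x t - (\<Sum>i<k. volterra A B N u i t))"
  have cont: "continuous_on {0..s} (R k)" for k s
    unfolding R_def by (intro continuous_intros continuous_on_volterra state_continuous[OF x])
  obtain L where L: "L > 0" "\<And>s h. s \<in> {0..t} \<Longrightarrow> h absolutely_integrable_on {0..s} \<Longrightarrow>
      norm (response A h s) \<le> L * integral {0..s} (\<lambda>s. norm (h s))"
    using response_norm_le[of t A] by blast
  obtain K where K: "K > 0" "\<And>w z. norm (bilin N w z) \<le> norm w * norm z * K"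
    using bounded_bilinear.pos_bounded[OF bounded_bilinear_bilin] by blast
  have "bounded (x ` {0..t})"
    by (intro compact_imp_bounded compact_continuous_image state_continuous[OF x]) auto
  then obtain X where X: "\<And>s. s \<in> {0..t} \<Longrightarrow> norm (x s) \<le> X"
    unfolding bounded_pos by (metis imageI)
  define V where "V = (\<lambda>s. integral {0..s} (\<lambda>s. norm (u s)))"
  have bound: "norm (R k s) \<le> X * (L * K) ^ k * (V s ^ k / fact k)" if "s \<in> {0..t}" for k s
    using that
  proof (induction k arbitrary: s)
    case 0
    thus ?case using X by (simp add: R_def)
  next
    case (Suc k)
    have ai: "(\<lambda>s. bilin N (u s) (R k s)) absolutely_integrable_on {0..s}"
      by (rule absolutely_integrable_bilin[OF cont])
    have nu: "(\<lambda>s. norm (u s)) absolutely_integrable_on {0..s}"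
      by (rule absolutely_integrable_norm_on[OF u])
    have Vc: "continuous_on {0..s} V"
      unfolding V_def using nu by (intro indefinite_integral_continuous_1) (simp add: absolutely_integrable_on_def)
    have "norm (R (Suc k) s) \<le> L * integral {0..s} (\<lambda>r. norm (bilin N (u r) (R k r)))"
      using L(2)[OF Suc.prems ai] volterra_remainder[OF x, of s k] Suc.prems by (simp add: R_def)
    also have "integral {0..s} (\<lambda>r. norm (bilin N (u r) (R k r))) \<le>
        integral {0..s} (\<lambda>r. (K * X * (L * K) ^ k) * (norm (u r) * (V r ^ k / fact k)))"
    proof (rule integral_le)
      show "(\<lambda>r. norm (bilin N (u r) (R k r))) integrable_on {0..s}"
        using ai by (simp add: absolutely_integrable_on_def)
      have "(\<lambda>r. norm (u r) * (V r ^ k / fact k)) absolutely_integrable_on {0..s}"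
        by (intro absolutely_integrable_bilinear_continuous[OF bounded_bilinear_mult nu] continuous_intros Vc) auto
      thus "(\<lambda>r. (K * X * (L * K) ^ k) * (norm (u r) * (V r ^ k / fact k))) integrable_on {0..s}"
        unfolding absolutely_integrable_on_def by (intro integrable_on_mult_right) auto
      fix r assume "r \<in> {0..s}"
      hence "norm (R k r) \<le> X * (L * K) ^ k * (V r ^ k / fact k)"
        using Suc.prems by (intro Suc.IH) auto
      hence "norm (u r) * norm (R k r) * K \<le> norm (u r) * (X * (L * K) ^ k * (V r ^ k / fact k)) * K"
        using K by (intro mult_right_mono mult_left_mono) auto
      thus "norm (bilin N (u r) (R k r)) \<le> (K * X * (L * K) ^ k) * (norm (u r) * (V r ^ k / fact k))"
        using K(2)[of "u r" "R k r"] by (simp add: algebra_simps)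
    qed
    also have "\<dots> = (K * X * (L * K) ^ k) * (V s ^ Suc k / fact (Suc k))"
      using integral_power_of_integral[OF _ nu, of k] Suc.prems
      by (simp only: V_def integral_mult_right atLeastAtMost_iff)
    finally show ?case using L(1) by (simp add: algebra_simps del: fact_Suc)
  qed
  have "(\<lambda>k. inverse (fact k) * (L * K * V t) ^ k) \<longlonglongrightarrow> 0"
    by (rule summable_LIMSEQ_zero[OF summable_exp])
  hence "(\<lambda>k. X * (inverse (fact k) * (L * K * V t) ^ k)) \<longlonglongrightarrow> 0"
    by (rule tendsto_mult_right_zero)
  hence "(\<lambda>k. R k t) \<longlonglongrightarrow> 0"
    by (rule Lim_null_comparison[rotated])
      (use bound[of t] t in \<open>auto simp: power_mult_distrib field_simps\<close>)
  hence "(\<lambda>k. x t - R k t) \<longlonglongrightarrow> x t - 0"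
    by (intro tendsto_diff tendsto_const)
  thus ?thesis by (simp add: R_def)
qed

end

section \<open>Iterated integrals of the input\<close>

text \<open>
  The integral of \<open>\<sigma> s\<^sub>0 * \<rho> s\<^sub>1 * \<dots> * \<rho> s\<^sub>i\<close> over \<open>0 \<le> s\<^sub>0 \<le> \<dots> \<le> s\<^sub>i \<le> t\<close>.
\<close>

primrec weight :: "(real \<Rightarrow> real) \<Rightarrow> (real \<Rightarrow> real) \<Rightarrow> nat \<Rightarrow> real \<Rightarrow> real" where
  "weight \<sigma> \<rho> 0 = (\<lambda>t. integral {0..t} \<sigma>)"
| "weight \<sigma> \<rho> (Suc i) = (\<lambda>t. integral {0..t} (\<lambda>s. \<rho> s * weight \<sigma> \<rho> i s))"

context
  fixes \<sigma> \<rho> :: "real \<Rightarrow> real"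
  assumes \<sigma>: "\<And>t. \<sigma> absolutely_integrable_on {0..t}" "\<And>s. 0 \<le> \<sigma> s"
    and \<rho>: "\<And>t. \<rho> absolutely_integrable_on {0..t}" "\<And>s. 0 \<le> \<rho> s"
begin

lemma weight_integrand:
  "continuous_on {0..t} (weight \<sigma> \<rho> i)" "(\<lambda>s. \<rho> s * weight \<sigma> \<rho> i s) integrable_on {0..t}"
proof -
  have "continuous_on {0..t} (weight \<sigma> \<rho> i) \<and> (\<lambda>s. \<rho> s * weight \<sigma> \<rho> i s) integrable_on {0..t}"
  proof (induction i)
    case 0
    have "continuous_on {0..t} (weight \<sigma> \<rho> 0)"
      using \<sigma>(1)[of t] by (auto intro: indefinite_integral_continuous_1 simp: absolutely_integrable_on_def)
    thus ?case
      using absolutely_integrable_bilinear_continuous[OF bounded_bilinear_mult \<rho>(1)]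
      unfolding absolutely_integrable_on_def by blast
  next
    case (Suc i)
    hence "continuous_on {0..t} (weight \<sigma> \<rho> (Suc i))"
      by (auto intro: indefinite_integral_continuous_1)
    thus ?case
      using absolutely_integrable_bilinear_continuous[OF bounded_bilinear_mult \<rho>(1)]
      unfolding absolutely_integrable_on_def by blast
  qed
  thus "continuous_on {0..t} (weight \<sigma> \<rho> i)" "(\<lambda>s. \<rho> s * weight \<sigma> \<rho> i s) integrable_on {0..t}" by auto
qed

lemma weight_nonneg: "0 \<le> weight \<sigma> \<rho> i t"
proof (induction i arbitrary: t)
  case 0
  show ?case using \<sigma> by (auto intro!: integral_nonneg simp: absolutely_integrable_on_def)
next
  case (Suc i)
  thus ?case using \<rho>(2) weight_integrand(2) by (auto intro!: integral_nonneg)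
qed

lemma weight_le:
  assumes Q: "\<And>t. integral {0..t} \<sigma> \<le> Q" and "0 \<le> t"
  shows "weight \<sigma> \<rho> i t \<le> Q * ((integral {0..t} \<rho>) ^ i / fact i)"
  using \<open>0 \<le> t\<close>
proof (induction i arbitrary: t)
  case 0
  show ?case using Q by simp
next
  case (Suc i)
  have c: "continuous_on {0..t} (\<lambda>s. integral {0..s} \<rho> ^ i / fact i)"
    using \<rho>(1)[of t]
    by (intro continuous_intros indefinite_integral_continuous_1) (auto simp: absolutely_integrable_on_def)
  have ai: "(\<lambda>s. \<rho> s * (integral {0..s} \<rho> ^ i / fact i)) integrable_on {0..t}"
    using absolutely_integrable_bilinear_continuous[OF bounded_bilinear_mult \<rho>(1) c]
    unfolding absolutely_integrable_on_def by blast
  have "weight \<sigma> \<rho> (Suc i) t \<le> integral {0..t} (\<lambda>s. Q * (\<rho> s * (integral {0..s} \<rho> ^ i / fact i)))"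
    unfolding weight.simps
  proof (rule integral_le[OF weight_integrand(2) integrable_on_mult_right[OF ai]])
    fix s assume "s \<in> {0..t}"
    thus "\<rho> s * weight \<sigma> \<rho> i s \<le> Q * (\<rho> s * (integral {0..s} \<rho> ^ i / fact i))"
      using mult_left_mono[OF Suc.IH \<rho>(2)] by (simp add: algebra_simps)
  qed
  also have "\<dots> = Q * ((integral {0..t} \<rho>) ^ Suc i / fact (Suc i))"
    by (simp only: integral_mult_right integral_power_of_integral[OF Suc.prems \<rho>(1)])
  finally show ?case .
qed

text \<open>
  The terms are dominated by those of the exponential series at \<open>\<integral> \<rho>\<close>.
\<close>

lemma sum_weight_le:
  assumes Q: "\<And>t. integral {0..t} \<sigma> \<le> Q" and E: "\<And>t. integral {0..t} \<rho> \<le> E" and "0 \<le> t"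
  shows "(\<Sum>i<n. weight \<sigma> \<rho> i t) \<le> exp E * Q"
proof -
  let ?U = "integral {0..t} \<rho>"
  have "0 \<le> Q" using Q[of 0] by simp
  have U: "0 \<le> ?U" using \<rho> by (auto intro!: integral_nonneg simp: absolutely_integrable_on_def)
  have "(\<Sum>i<n. inverse (fact i) * ?U ^ i) \<le> exp ?U"
    using sum_le_suminf[OF summable_exp[of ?U], of "{..<n}"] U by (simp add: exp_def)
  also have "\<dots> \<le> exp E" using E by simp
  finally have exp: "(\<Sum>i<n. inverse (fact i) * ?U ^ i) \<le> exp E" .
  have "(\<Sum>i<n. weight \<sigma> \<rho> i t) \<le> Q * (\<Sum>i<n. inverse (fact i) * ?U ^ i)"
    unfolding sum_distrib_left using weight_le[OF Q \<open>0 \<le> t\<close>]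
    by (intro sum_mono) (simp add: field_simps)
  also have "\<dots> \<le> Q * exp E"
    using exp \<open>0 \<le> Q\<close> by (rule mult_left_mono)
  finally show ?thesis by (simp add: mult.commute)
qed

end

section \<open>Quadratic forms of the Gramians of the kernels\<close>

lemma finite_words [simp]: "finite (words i :: 'm::finite list set)"
  using finite_lists_length_eq[of "UNIV :: 'm set" i] by (simp add: words_def)

lemma sum_words_Suc:
  "(\<Sum>l\<in>words (Suc i). f (hd l) (tl l)) = (\<Sum>k\<in>(UNIV :: 'm::finite set). \<Sum>l\<in>words i. f k l)"
proof -
  have "bij_betw (\<lambda>(k, l). k # l) (UNIV \<times> words i) (words (Suc i) :: 'm list set)"
    by (rule bij_betw_byWitness[where f' = "\<lambda>l. (hd l, tl l)"]) (auto simp: words_def length_Suc_conv)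
  from sum.reindex_bij_betw[OF this, of "\<lambda>l. f (hd l) (tl l)"]
  show ?thesis by (simp add: sum.cartesian_product case_prod_beta)
qed

lemma N_block_mult_kron_vec: "N_block N *v kron_vec (column k (mat 1)) w = N k *v w"
proof -
  have "(\<Sum>q\<in>UNIV. N (fst q) $ r $ snd q * ((if fst q = k then 1 else 0) * w $ snd q)) = (\<Sum>s\<in>UNIV. N k $ r $ s * w $ s)" for r
  proof -
    have "(\<Sum>q\<in>UNIV. N (fst q) $ r $ snd q * ((if fst q = k then 1 else 0) * w $ snd q))
        = (\<Sum>k'\<in>UNIV. \<Sum>s\<in>UNIV. N k' $ r $ s * ((if k' = k then 1 else 0) * w $ s))"
      by (simp add: sum.cartesian_product case_prod_beta flip: UNIV_Times_UNIV)
    also have "\<dots> = (\<Sum>k'\<in>UNIV. if k' = k then \<Sum>s\<in>UNIV. N k $ r $ s * w $ s else 0)"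
      by (intro sum.cong) auto
    finally show ?thesis by simp
  qed
  thus ?thesis
    by (simp add: vec_eq_iff matrix_vector_mult_def N_block_def kron_vec_def column_def mat_def)
qed

text \<open>
  The block matrix and the Kronecker product in the definition select the matrix that belongs to the first letter.
\<close>

lemma P_bar_Suc_Suc:
  "P_bar A B N (Suc (Suc i)) t l = exp_at A (t (Suc (Suc i))) *v (N (hd l) *v P_bar A B N (Suc i) t (tl l))"
  by (simp add: kron_cols_def exp_at_def matrix_vector_mul_assoc[symmetric] N_block_mult_kron_vec)

lemma P_bar_cong:
  "(\<And>k. k \<in> {1..i} \<Longrightarrow> t k = s k) \<Longrightarrow> P_bar A B N i t = P_bar A B N i s"
proof (induction i)
  case (Suc i)
  thus ?case by (cases i) (auto simp: kron_cols_def)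
qed simp

abbreviation half_line :: "real measure" where
  "half_line \<equiv> restrict_space lborel {0..}"

interpretation half_lines: product_sigma_finite "\<lambda>_ :: nat. half_line"
  by standard (metis sigma_finite_lborel sigma_finite_measure_restrict_space atLeast_borel sets_lborel
      sigma_finite_measure.sigma_finite_countable)

lemma sigma_finite_orthant: "sigma_finite_measure (orthant i)"
  unfolding orthant_def by (rule half_lines.sigma_finite) simp

lemma measurable_orthant_component [measurable]:
  "k \<in> {1..i} \<Longrightarrow> (\<lambda>t. t k) \<in> borel_measurable (orthant i)"
  unfolding orthant_def
  by (rule measurable_compose[OF measurable_component_singleton]) (auto intro: measurable_restrict_space1)

lemma borel_measurable_exp_at [measurable]: "exp_at A \<in> borel_measurable borel"
  by (intro borel_measurable_continuous_onI continuous_on_exp_at)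

lemma borel_measurable_matrix_vector_mult [measurable (raw)]:
  fixes f :: "'a \<Rightarrow> real^'c^'b" and g :: "'a \<Rightarrow> real^'c"
  assumes "f \<in> borel_measurable M" "g \<in> borel_measurable M"
  shows "(\<lambda>x. f x *v g x) \<in> borel_measurable M"
  by (rule borel_measurable_continuous_Pair[OF assms])
    (intro bounded_bilinear.continuous_on[OF bounded_bilinear_matrix_vector_mult] continuous_intros)

lemma borel_measurable_transpose [measurable]: "transpose \<in> borel_measurable (borel :: (real^'b^'a) measure)"
  unfolding transpose_def by (intro borel_measurable_continuous_onI continuous_intros)

lemma measurable_P_bar:
  "i \<le> j \<Longrightarrow> (\<lambda>t. P_bar A B N i t l) \<in> borel_measurable (orthant j)"
proof (induction i arbitrary: l)
  case (Suc i)
  show ?case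
  proof (cases i)
    case 0
    have [measurable]: "(\<lambda>t. t (Suc 0)) \<in> borel_measurable (orthant j)"
      using Suc.prems by (intro measurable_orthant_component) auto
    show ?thesis using 0 by (simp add: exp_at_def[symmetric])
  next
    case (Suc i')
    have [measurable]: "(\<lambda>t. t (Suc i)) \<in> borel_measurable (orthant j)"
      using Suc.prems by (intro measurable_orthant_component) auto
    have [measurable]: "(\<lambda>t. P_bar A B N i t l) \<in> borel_measurable (orthant j)" for l
      using Suc.IH Suc.prems by simp
    show ?thesis unfolding Suc P_bar_Suc_Suc unfolding Suc[symmetric] by measurable
  qed
qed simp

text \<open>
  The value \<open>v\<^sup>T P\<^sub>i v\<close>, where \<open>P\<^sub>i\<close> is the integral of the kernel of index \<open>i\<close> times its transpose. As an
  extended nonnegative real it exists without convergence assumptions.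
\<close>

definition gramian_form ::
  "real^'n^'n \<Rightarrow> real^'m^'n \<Rightarrow> ('m \<Rightarrow> real^'n^'n) \<Rightarrow> nat \<Rightarrow> real^'n \<Rightarrow> ennreal" where
  "gramian_form A B N i v = (\<integral>\<^sup>+t. (\<Sum>l\<in>words i. ennreal ((v \<bullet> P_bar A B N i t l)\<^sup>2)) \<partial>orthant i)"

lemma measurable_gramian_form [measurable]: "gramian_form A B N i \<in> borel_measurable borel"
proof -
  have [measurable]: "(\<lambda>t. P_bar A B N i t l) \<in> borel_measurable (orthant i)" for l
    by (rule measurable_P_bar) simp
  show ?thesis
    unfolding gramian_form_def
    by (intro sigma_finite_measure.borel_measurable_nn_integral[OF sigma_finite_orthant]) measurable
qed

lemma inner_matrix_vector_mult: "v \<bullet> (X *v w) = (transpose X *v v) \<bullet> (w :: real^'a)" for X :: "real^'a^'b"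
  by (metis dot_lmul_matrix transpose_matrix_vector)

lemma gramian_form_1:
  "gramian_form A B N (Suc 0) v =
     (\<integral>\<^sup>+\<tau>. (\<Sum>k\<in>UNIV. ennreal ((v \<bullet> (exp_at A \<tau> *v column k B))\<^sup>2)) \<partial>half_line)"
proof -
  have [measurable]: "(\<lambda>\<tau>. \<tau>) \<in> borel_measurable half_line"
    by (auto intro: measurable_restrict_space1)
  have "(\<Sum>l\<in>words (Suc 0). ennreal ((v \<bullet> P_bar A B N (Suc 0) t l)\<^sup>2)) =
      (\<Sum>k\<in>UNIV. ennreal ((v \<bullet> (exp_at A (t (Suc 0)) *v column k B))\<^sup>2))" for t
    using sum_words_Suc[of "\<lambda>k l. ennreal ((v \<bullet> (exp_at A (t (Suc 0)) *v column k B))\<^sup>2)" 0]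
    by (simp add: words_def exp_at_def)
  hence "gramian_form A B N (Suc 0) v =
      (\<integral>\<^sup>+t. (\<Sum>k\<in>UNIV. ennreal ((v \<bullet> (exp_at A (t (Suc 0)) *v column k B))\<^sup>2)) \<partial>PiM {Suc 0} (\<lambda>_. half_line))"
    by (simp add: gramian_form_def orthant_def)
  also have "\<dots> = (\<integral>\<^sup>+\<tau>. (\<Sum>k\<in>UNIV. ennreal ((v \<bullet> (exp_at A \<tau> *v column k B))\<^sup>2)) \<partial>half_line)"
    by (rule half_lines.product_nn_integral_singleton) measurable
  finally show ?thesis .
qed

text \<open>
  Fubini separates the last time variable \<open>\<tau>\<close>, on which the inner kernel does not depend; the factors
  \<open>e\<^bsup>A \<tau>\<^esup>\<close> and \<open>N\<^sub>k\<close> move to the other side of the inner product.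
\<close>

lemma gramian_form_Suc:
  "gramian_form A B N (Suc (Suc i)) v =
     (\<integral>\<^sup>+\<tau>. (\<Sum>k\<in>UNIV. gramian_form A B N (Suc i) (transpose (N k) *v (transpose (exp_at A \<tau>) *v v))) \<partial>half_line)"
proof -
  let ?w = "\<lambda>\<tau> k. transpose (N k) *v (transpose (exp_at A \<tau>) *v v)"
  let ?f = "\<lambda>t. \<Sum>k\<in>UNIV. \<Sum>l\<in>words (Suc i). ennreal ((?w (t (Suc (Suc i))) k \<bullet> P_bar A B N (Suc i) t l)\<^sup>2)"
  have Icc: "{1..Suc (Suc i)} = insert (Suc (Suc i)) {1..Suc i}" by auto
  have "(\<Sum>l\<in>words (Suc (Suc i)). ennreal ((v \<bullet> P_bar A B N (Suc (Suc i)) t l)\<^sup>2)) = ?f t" for t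
    unfolding P_bar_Suc_Suc inner_matrix_vector_mult
    by (rule sum_words_Suc)
  hence "gramian_form A B N (Suc (Suc i)) v = (\<integral>\<^sup>+t. ?f t \<partial>orthant (Suc (Suc i)))"
    by (simp only: gramian_form_def)
  also have "\<dots> = (\<integral>\<^sup>+t. ?f t \<partial>PiM (insert (Suc (Suc i)) {1..Suc i}) (\<lambda>_. half_line))"
    by (simp only: orthant_def Icc)
  also have "\<dots> = (\<integral>\<^sup>+\<tau>. \<integral>\<^sup>+t. ?f (t(Suc (Suc i) := \<tau>)) \<partial>PiM {1..Suc i} (\<lambda>_. half_line) \<partial>half_line)"
  proof (rule half_lines.product_nn_integral_insert_rev)
    have [measurable]: "(\<lambda>t. t (Suc (Suc i))) \<in> borel_measurable (orthant (Suc (Suc i)))"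
      by (intro measurable_orthant_component) auto
    have [measurable]: "(\<lambda>t. P_bar A B N (Suc i) t l) \<in> borel_measurable (orthant (Suc (Suc i)))" for l
      by (intro measurable_P_bar) simp
    have "?f \<in> borel_measurable (orthant (Suc (Suc i)))" by measurable
    thus "?f \<in> borel_measurable (PiM (insert (Suc (Suc i)) {1..Suc i}) (\<lambda>_. half_line))"
      by (simp only: orthant_def Icc)
  qed auto
  also have "\<dots> = (\<integral>\<^sup>+\<tau>. \<integral>\<^sup>+t. (\<Sum>k\<in>UNIV. \<Sum>l\<in>words (Suc i). ennreal ((?w \<tau> k \<bullet> P_bar A B N (Suc i) t l)\<^sup>2)) \<partial>orthant (Suc i) \<partial>half_line)"
  proof -
    have "P_bar A B N (Suc i) (t(Suc (Suc i) := \<tau>)) = P_bar A B N (Suc i) t" for t \<tau>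
      by (rule P_bar_cong) auto
    thus ?thesis by (simp add: orthant_def)
  qed
  also have "\<dots> = (\<integral>\<^sup>+\<tau>. (\<Sum>k\<in>UNIV. gramian_form A B N (Suc i) (?w \<tau> k)) \<partial>half_line)"
  proof -
    have [measurable]: "(\<lambda>t. P_bar A B N (Suc i) t l) \<in> borel_measurable (orthant (Suc i))" for l
      by (rule measurable_P_bar) simp
    show ?thesis
      unfolding gramian_form_def by (intro nn_integral_cong nn_integral_sum) measurable
  qed
  finally show ?thesis .
qed

section \<open>Bounds for the terms of the Volterra series\<close>

lemma sum_mult_sq_le_ennreal:
  "ennreal ((\<Sum>k\<in>UNIV. (a :: real^'m) $ k * b k)\<^sup>2) \<le> ennreal ((norm a)\<^sup>2) * (\<Sum>k\<in>UNIV. ennreal ((b k)\<^sup>2))"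
proof -
  have "(\<Sum>k\<in>UNIV. a $ k * b k)\<^sup>2 \<le> (norm a)\<^sup>2 * (\<Sum>k\<in>UNIV. (b k)\<^sup>2)"
    using Cauchy_Schwarz_ineq_sum[of "\<lambda>k. a $ k" b UNIV] by (simp add: power2_norm_vec)
  thus ?thesis by (simp add: sum_ennreal ennreal_mult[symmetric] sum_nonneg ennreal_leI)
qed

lemma bilin_input0: "bilin N (input0 N u s) z = bilin N (u s) z"
  unfolding bilin_def input0_def by (intro sum.cong) auto

text \<open>
  In each step \<open>v \<bullet> x\<^sub>i\<^sub>+\<^sub>1(t)\<close> is the integral of \<open>\<Sum>k. u\<^sup>0\<^sub>k(s) (w\<^sub>k \<bullet> x\<^sub>i(s))\<close> with
  \<open>w\<^sub>k = N\<^sub>k\<^sup>T e\<^bsup>A\<^sup>T (t - s)\<^esup> v\<close>. The Cauchy-Schwarz inequality for the sum over \<open>k\<close>, the induction hypothesis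
  for the vectors \<open>w\<^sub>k\<close>, and the Cauchy-Schwarz inequality for the convolution reproduce the recursions of
  \<open>weight\<close> and \<open>gramian_form\<close>.
\<close>

lemma volterra_sq_le:
  fixes A :: "real^'n^'n" and B :: "real^'m^'n"
  assumes u: "\<And>t. u absolutely_integrable_on {0..t}"
    and \<sigma>: "\<And>t. (\<lambda>s. (norm (u s))\<^sup>2) absolutely_integrable_on {0..t}"
    and \<rho>: "\<And>t. (\<lambda>s. (norm (input0 N u s))\<^sup>2) absolutely_integrable_on {0..t}"
  defines "c \<equiv> weight (\<lambda>s. (norm (u s))\<^sup>2) (\<lambda>s. (norm (input0 N u s))\<^sup>2)"
  shows "ennreal ((v \<bullet> volterra A B N u i t)\<^sup>2) \<le> ennreal (c i t) * gramian_form A B N (Suc i) v"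
proof (induction i arbitrary: v t)
  case 0
  let ?\<beta> = "\<lambda>\<tau>. \<Sum>k\<in>UNIV. ennreal ((v \<bullet> (exp_at A \<tau> *v column k B))\<^sup>2)"
  note r = inner_response[where v = v and A = A, OF absolutely_integrable_input[where B = B and t = t, OF u]]
  have "ennreal ((integral {0..t} (\<lambda>s. (transpose (exp_at A (t - s)) *v v) \<bullet> (B *v u s)))\<^sup>2)
      \<le> ennreal (integral {0..t} (\<lambda>s. (norm (u s))\<^sup>2)) * (\<integral>\<^sup>+\<tau>. ?\<beta> \<tau> \<partial>half_line)"
  proof (rule convolution_Cauchy_Schwarz[OF r(2)])
    fix s
    have "(transpose (exp_at A (t - s)) *v v) \<bullet> (B *v u s) = (\<Sum>k\<in>UNIV. u s $ k * (v \<bullet> (exp_at A (t - s) *v column k B)))"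
      unfolding inner_matrix_vector_mult[symmetric] matrix_mult_sum[of B] 
      by (simp add: inner_sum_right linear_sum[OF matrix_vector_mul_linear] scalar_mult_eq_scaleR matrix_vector_mult_scaleR)
    thus "ennreal (((transpose (exp_at A (t - s)) *v v) \<bullet> (B *v u s))\<^sup>2) \<le> ennreal ((norm (u s))\<^sup>2) * ?\<beta> (t - s)"
      by (simp only: sum_mult_sq_le_ennreal)
  qed (use \<sigma>[of t] in \<open>auto simp: absolutely_integrable_on_def\<close>)
  thus ?case by (simp only: r(1) c_def gramian_form_1 weight.simps volterra.simps)
next
  case (Suc i)
  let ?w = "\<lambda>\<tau> k. transpose (N k) *v (transpose (exp_at A \<tau>) *v v)"
  let ?\<beta> = "\<lambda>\<tau>. \<Sum>k\<in>UNIV. gramian_form A B N (Suc i) (?w \<tau> k)"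
  let ?z = "volterra A B N u i"
  note r = inner_response[where v = v and A = A and t = t,
      OF absolutely_integrable_bilin[where N = N, OF u continuous_on_volterra[where A = A and B = B and N = N and i = i, OF u]]]
  have "ennreal ((integral {0..t} (\<lambda>s. (transpose (exp_at A (t - s)) *v v) \<bullet> bilin N (u s) (?z s)))\<^sup>2)
      \<le> ennreal (integral {0..t} (\<lambda>s. (norm (input0 N u s))\<^sup>2 * c i s)) * (\<integral>\<^sup>+\<tau>. ?\<beta> \<tau> \<partial>half_line)"
  proof (rule convolution_Cauchy_Schwarz[OF r(2)])
    show "(\<lambda>s. (norm (input0 N u s))\<^sup>2 * c i s) integrable_on {0..t}"
      unfolding c_def by (rule weight_integrand[OF \<sigma> _ \<rho>]) auto
    have c0: "0 \<le> c i s" for s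
      unfolding c_def by (rule weight_nonneg[OF \<sigma> _ \<rho>]) auto
    thus "0 \<le> (norm (input0 N u s))\<^sup>2 * c i s" for s by simp
    fix s
    have "(transpose (exp_at A (t - s)) *v v) \<bullet> bilin N (u s) (?z s) = (\<Sum>k\<in>UNIV. input0 N u s $ k * (?w (t - s) k \<bullet> ?z s))"
      unfolding bilin_input0[of N u s, symmetric] unfolding bilin_def
      by (simp add: inner_sum_right inner_matrix_vector_mult)
    hence "ennreal (((transpose (exp_at A (t - s)) *v v) \<bullet> bilin N (u s) (?z s))\<^sup>2)
        \<le> ennreal ((norm (input0 N u s))\<^sup>2) * (\<Sum>k\<in>UNIV. ennreal ((?w (t - s) k \<bullet> ?z s)\<^sup>2))"
      by (simp only: sum_mult_sq_le_ennreal)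
    also have "\<dots> \<le> ennreal ((norm (input0 N u s))\<^sup>2) * (\<Sum>k\<in>UNIV. ennreal (c i s) * gramian_form A B N (Suc i) (?w (t - s) k))"
      by (intro mult_left_mono sum_mono Suc.IH) auto
    also have "\<dots> = ennreal ((norm (input0 N u s))\<^sup>2 * c i s) * ?\<beta> (t - s)"
      by (simp add: ennreal_mult c0 sum_distrib_left mult.assoc)
    finally show "ennreal (((transpose (exp_at A (t - s)) *v v) \<bullet> bilin N (u s) (?z s))\<^sup>2)
        \<le> ennreal ((norm (input0 N u s))\<^sup>2 * c i s) * ?\<beta> (t - s)" .
  qed measurable
  thus ?case by (simp only: r(1) c_def gramian_form_Suc weight.simps volterra.simps)
qed

section \<open>The outputs and the H2 norm\<close>

definition quad_output :: "('p::finite \<Rightarrow> real^'n^'n) \<Rightarrow> real^'n \<Rightarrow> real^'n \<Rightarrow> real^'p" where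
  "quad_output M x z = (\<chi> j. x \<bullet> (M j *v z))"

lemma bounded_bilinear_quad_output: "bounded_bilinear (quad_output M)"
proof -
  have "bilinear (quad_output M)"
    unfolding bilinear_def quad_output_def
    by (auto intro!: linearI simp: vec_eq_iff inner_add_left inner_add_right matrix_vector_right_distrib
        matrix_vector_mult_scaleR)
  thus ?thesis by (simp add: bilinear_conv_bounded_bilinear)
qed

lemma M_vec_mult_kron_vec: "M_vec M *v kron_vec p q = quad_output M q p"
proof -
  have "(\<Sum>cr\<in>UNIV. M j $ snd cr $ fst cr * (p $ fst cr * q $ snd cr)) = q \<bullet> (M j *v p)" for j
  proof -
    have "(\<Sum>cr\<in>UNIV. M j $ snd cr $ fst cr * (p $ fst cr * q $ snd cr))
        = (\<Sum>c\<in>UNIV. \<Sum>r\<in>UNIV. M j $ r $ c * (p $ c * q $ r))"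
      by (simp add: sum.cartesian_product case_prod_beta flip: UNIV_Times_UNIV)
    also have "\<dots> = (\<Sum>r\<in>UNIV. \<Sum>c\<in>UNIV. M j $ r $ c * (p $ c * q $ r))"
      by (rule sum.swap)
    also have "\<dots> = q \<bullet> (M j *v p)"
      by (simp add: inner_vec_def matrix_vector_mult_def sum_distrib_left algebra_simps)
    finally show ?thesis .
  qed
  thus ?thesis by (simp add: vec_eq_iff matrix_vector_mult_def M_vec_def kron_vec_def quad_output_def)
qed

lemma h_C_integral:
  "(\<integral>\<^sup>+t. ennreal (frobenius_sq (words i) (h_C A B C N i t)) \<partial>orthant i)
     = (\<Sum>j\<in>UNIV. gramian_form A B N i (C $ j))"
proof -
  have [measurable]: "(\<lambda>t. P_bar A B N i t l) \<in> borel_measurable (orthant i)" for l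
    by (rule measurable_P_bar) simp
  have "ennreal (frobenius_sq (words i) (h_C A B C N i t)) =
      (\<Sum>j\<in>UNIV. \<Sum>l\<in>words i. ennreal ((C $ j \<bullet> P_bar A B N i t l)\<^sup>2))" for t
    by (simp add: frobenius_sq_def h_C_def power2_norm_vec matrix_vector_mul_component sum_ennreal sum_nonneg
        sum.swap[of _ UNIV])
  thus ?thesis
    by (simp only:) (unfold gramian_form_def, subst nn_integral_sum, auto)
qed

lemma h_M_integral:
  "(\<integral>\<^sup>+s. ennreal (frobenius_sq (words i \<times> words j) (h_M A B N M i j t s)) \<partial>orthant j)
     = (\<Sum>k\<in>UNIV. \<Sum>l\<in>words i. gramian_form A B N j (M k *v P_bar A B N i t l))"
proof -
  have [measurable]: "(\<lambda>t. P_bar A B N j t l) \<in> borel_measurable (orthant j)" for l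
    by (rule measurable_P_bar) simp
  have "ennreal (frobenius_sq (words i \<times> words j) (h_M A B N M i j t s)) =
      (\<Sum>k\<in>UNIV. \<Sum>l\<in>words i. \<Sum>l'\<in>words j. ennreal (((M k *v P_bar A B N i t l) \<bullet> P_bar A B N j s l')\<^sup>2))" for s
  proof -
    have "frobenius_sq (words i \<times> words j) (h_M A B N M i j t s) =
        (\<Sum>l\<in>words i. \<Sum>l'\<in>words j. \<Sum>k\<in>UNIV. ((M k *v P_bar A B N i t l) \<bullet> P_bar A B N j s l')\<^sup>2)"
      by (rule trans[OF _ sum.cartesian_product[symmetric]])
        (simp add: frobenius_sq_def h_M_def kron_cols_def M_vec_mult_kron_vec power2_norm_vec quad_output_def
          case_prod_beta inner_commute)
    also have "\<dots> = (\<Sum>l\<in>words i. \<Sum>k\<in>UNIV. \<Sum>l'\<in>words j. ((M k *v P_bar A B N i t l) \<bullet> P_bar A B N j s l')\<^sup>2)"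
      by (intro sum.cong sum.swap refl)
    also have "\<dots> = (\<Sum>k\<in>UNIV. \<Sum>l\<in>words i. \<Sum>l'\<in>words j. ((M k *v P_bar A B N i t l) \<bullet> P_bar A B N j s l')\<^sup>2)"
      by (rule sum.swap)
    finally show ?thesis by (simp add: sum_ennreal sum_nonneg)
  qed
  hence "(\<integral>\<^sup>+s. ennreal (frobenius_sq (words i \<times> words j) (h_M A B N M i j t s)) \<partial>orthant j) =
     (\<integral>\<^sup>+s. (\<Sum>k\<in>UNIV. \<Sum>l\<in>words i. \<Sum>l'\<in>words j. ennreal (((M k *v P_bar A B N i t l) \<bullet> P_bar A B N j s l')\<^sup>2)) \<partial>orthant j)"
    by (simp only:)
  also have "\<dots> = (\<Sum>k\<in>UNIV. \<integral>\<^sup>+s. (\<Sum>l\<in>words i. \<Sum>l'\<in>words j. ennreal (((M k *v P_bar A B N i t l) \<bullet> P_bar A B N j s l')\<^sup>2)) \<partial>orthant j)"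
    by (rule nn_integral_sum) measurable
  also have "\<dots> = (\<Sum>k\<in>UNIV. \<Sum>l\<in>words i. gramian_form A B N j (M k *v P_bar A B N i t l))"
    unfolding gramian_form_def by (intro sum.cong refl nn_integral_sum) measurable
  finally show ?thesis .
qed

lemma linear_output_le:
  assumes x: "\<And>v. ennreal ((v \<bullet> x)\<^sup>2) \<le> ennreal c * gramian_form A B N i v"
  shows "(ennreal (norm (C *v x)))\<^sup>2 \<le>
    ennreal c * (\<integral>\<^sup>+t. ennreal (frobenius_sq (words i) (h_C A B C N i t)) \<partial>orthant i)"
proof -
  have "(ennreal (norm (C *v x)))\<^sup>2 = (\<Sum>j\<in>UNIV. ennreal ((C $ j \<bullet> x)\<^sup>2))"
    by (simp add: ennreal_power power2_norm_vec matrix_vector_mul_component sum_ennreal)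
  also have "\<dots> \<le> (\<Sum>j\<in>UNIV. ennreal c * gramian_form A B N i (C $ j))"
    by (intro sum_mono x)
  finally show ?thesis by (simp add: h_C_integral sum_distrib_left)
qed

text \<open>
  The bounds for \<open>x\<close> and \<open>z\<close> are used one after the other, each time with a vector that contains the
  other factor: first \<open>v = M\<^sub>k\<^sup>T z\<close> replaces \<open>x\<close> by the columns \<open>p\<close> of its kernel, then \<open>v = M\<^sub>k p\<close> replaces
  \<open>z\<close>.
\<close>

lemma quadratic_output_le:
  assumes x: "\<And>v. ennreal ((v \<bullet> x)\<^sup>2) \<le> ennreal c * gramian_form A B N i v"
    and z: "\<And>v. ennreal ((v \<bullet> z)\<^sup>2) \<le> ennreal d * gramian_form A B N j v"
    and "0 \<le> c" "0 \<le> d"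
  shows "(ennreal (norm (quad_output M z x)))\<^sup>2 \<le> ennreal (c * d) *
    (\<integral>\<^sup>+t. \<integral>\<^sup>+s. ennreal (frobenius_sq (words i \<times> words j) (h_M A B N M i j t s)) \<partial>orthant j \<partial>orthant i)"
proof -
  have [measurable]: "(\<lambda>t. P_bar A B N i t l) \<in> borel_measurable (orthant i)" for l
    by (rule measurable_P_bar) simp
  have eq: "z \<bullet> (M k *v p) = (transpose (M k) *v z) \<bullet> p" for k p
    by (rule inner_matrix_vector_mult)
  have "(ennreal (norm (quad_output M z x)))\<^sup>2 = (\<Sum>k\<in>UNIV. ennreal (((transpose (M k) *v z) \<bullet> x)\<^sup>2))"
    by (simp add: ennreal_power power2_norm_vec quad_output_def eq sum_ennreal)
  also have "\<dots> \<le> (\<Sum>k\<in>UNIV. ennreal c * gramian_form A B N i (transpose (M k) *v z))"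
    by (intro sum_mono x)
  also have "\<dots> = ennreal c * (\<Sum>k\<in>UNIV. \<integral>\<^sup>+t. (\<Sum>l\<in>words i. ennreal (((M k *v P_bar A B N i t l) \<bullet> z)\<^sup>2)) \<partial>orthant i)"
    unfolding gramian_form_def eq[symmetric] by (simp add: sum_distrib_left inner_commute)
  also have "\<dots> = ennreal c * (\<integral>\<^sup>+t. (\<Sum>k\<in>UNIV. \<Sum>l\<in>words i. ennreal (((M k *v P_bar A B N i t l) \<bullet> z)\<^sup>2)) \<partial>orthant i)"
    by (intro arg_cong2[where f = "(*)"] refl nn_integral_sum[symmetric]) measurable
  also have "\<dots> \<le> ennreal c * (\<integral>\<^sup>+t. (\<Sum>k\<in>UNIV. \<Sum>l\<in>words i. ennreal d * gramian_form A B N j (M k *v P_bar A B N i t l)) \<partial>orthant i)"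
    by (intro mult_left_mono nn_integral_mono sum_mono z) auto
  also have "\<dots> = ennreal c * (\<integral>\<^sup>+t. ennreal d * (\<Sum>k\<in>UNIV. \<Sum>l\<in>words i. gramian_form A B N j (M k *v P_bar A B N i t l)) \<partial>orthant i)"
    by (simp add: sum_distrib_left)
  also have "\<dots> = ennreal c * (ennreal d * (\<integral>\<^sup>+t. (\<Sum>k\<in>UNIV. \<Sum>l\<in>words i. gramian_form A B N j (M k *v P_bar A B N i t l)) \<partial>orthant i))"
    by (intro arg_cong2[where f = "(*)"] refl nn_integral_cmult) measurable
  finally show ?thesis
    using \<open>0 \<le> c\<close> \<open>0 \<le> d\<close> by (simp only: h_M_integral ennreal_mult mult.assoc)
qed

section \<open>Square integrable inputs\<close>

lemma L2_input_absolutely_integrable: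
  fixes v :: "real \<Rightarrow> real^'m"
  assumes "L2_input v"
  shows "(\<lambda>s. (norm (v s))\<^sup>2) absolutely_integrable_on {0..t}"
    and "v absolutely_integrable_on {0..t}"
    and "integral {0..t} (\<lambda>s. (norm (v s))\<^sup>2) \<le> L2_norm_sq v"
proof -
  have int: "integrable (lebesgue_on {0..}) (\<lambda>s. (norm (v s))\<^sup>2)" and meas: "v \<in> borel_measurable (lebesgue_on {0..})"
    using assms by (auto simp: L2_input_def)
  have ai: "(\<lambda>s. (norm (v s))\<^sup>2) absolutely_integrable_on {0..}"
    using int by (simp add: integrable_restrict_space set_integrable_def)
  show sq: "(\<lambda>s. (norm (v s))\<^sup>2) absolutely_integrable_on {0..t}"
    using ai by (rule set_integrable_subset) auto
  show "v absolutely_integrable_on {0..t}"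
  proof (rule measurable_bounded_by_integrable_imp_absolutely_integrable)
    show "v \<in> borel_measurable (lebesgue_on {0..t})"
      using meas by (rule measurable_restrict_mono) auto
    show "(\<lambda>s. 1 + (norm (v s))\<^sup>2) integrable_on {0..t}"
      using sq by (intro integrable_add) (auto simp: absolutely_integrable_on_def)
    show "norm (v s) \<le> 1 + (norm (v s))\<^sup>2" for s
      using zero_le_power2[of "norm (v s) - 1 / 2"] by (simp add: power2_eq_square algebra_simps)
  qed auto
  have "integral {0..t} (\<lambda>s. (norm (v s))\<^sup>2) \<le> integral {0..} (\<lambda>s. (norm (v s))\<^sup>2)"
    using ai sq by (intro integral_subset_le) (auto simp: absolutely_integrable_on_def)
  thus "integral {0..t} (\<lambda>s. (norm (v s))\<^sup>2) \<le> L2_norm_sq v"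
    unfolding L2_norm_sq_def using lebesgue_integral_eq_integral[OF int] by simp
qed

lemma L2_input_input0:
  assumes "L2_input u"
  shows "L2_input (input0 N u)"
proof -
  define T where "T = (\<lambda>w :: real^'a. (\<chi> k. if N k = 0 then 0 else w $ k) :: real^'a)"
  have "linear T" by (auto intro!: linearI simp: T_def vec_eq_iff)
  hence T: "T \<in> borel_measurable borel"
    by (intro borel_measurable_continuous_onI linear_continuous_on) (simp add: linear_conv_bounded_linear)
  have eq: "input0 N u = (\<lambda>s. T (u s))" by (auto simp: input0_def T_def)
  have meas: "input0 N u \<in> borel_measurable (lebesgue_on {0..})"
    unfolding eq using assms by (intro measurable_compose[OF _ T]) (simp add: L2_input_def)
  moreover have "integrable (lebesgue_on {0..}) (\<lambda>s. (norm (input0 N u s))\<^sup>2)"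
  proof (rule Bochner_Integration.integrable_bound)
    show "integrable (lebesgue_on {0..}) (\<lambda>s. (norm (u s))\<^sup>2)"
      using assms by (simp add: L2_input_def)
    show "AE s in lebesgue_on {0..}. norm ((norm (input0 N u s))\<^sup>2) \<le> norm ((norm (u s))\<^sup>2)"
      by (auto simp: power2_norm_vec input0_def abs_of_nonneg sum_nonneg intro!: AE_I2 sum_mono)
  qed (use meas in measurable)
  ultimately show ?thesis by (simp add: L2_input_def)
qed

lemma L2_norm_sq_kron_eq: "L2_norm_sq_kron u = (L2_norm_sq u)\<^sup>2"
proof -
  have "(norm (kron_vec v w))\<^sup>2 = (norm v)\<^sup>2 * (norm w)\<^sup>2" for v w :: "real^'a"
  proof -
    have "(norm (kron_vec v w))\<^sup>2 = (\<Sum>a\<in>UNIV. \<Sum>b\<in>UNIV. (v $ a * w $ b)\<^sup>2)"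
      by (simp add: power2_norm_vec kron_vec_def sum.cartesian_product case_prod_beta flip: UNIV_Times_UNIV)
    thus ?thesis by (simp add: power2_norm_vec power_mult_distrib sum_product)
  qed
  thus ?thesis by (simp add: L2_norm_sq_kron_def L2_norm_sq_def power2_eq_square)
qed

section \<open>The bound for the output\<close>

text \<open>
  For a partial sum of the series, the output is a finite sum of terms \<open>C x\<^sub>i\<close> and
  \<open>x\<^sub>j\<^sup>T M x\<^sub>i\<close>, each bounded by the square root of a weight (\<open>c\<^sub>i\<close> or \<open>c\<^sub>i c\<^sub>j\<close>) times a term of the H2
  norm. As the \<open>c\<^sub>i\<close> add up to at most \<open>K = exp(|u\<^sup>0|\<^sup>2) |u|\<^sup>2\<close> (with \<open>L\<^sup>2\<close> norms), all weights add up to at most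
  \<open>K + K\<^sup>2\<close>, which is the factor in the claim because \<open>|u \<otimes> u| = |u|\<^sup>2\<close>.
\<close>

lemma output_at_time_le:
  fixes A :: "real^'n^'n" and B :: "real^'m^'n" and C :: "real^'n^'p"
  assumes u: "L2_input u" and x: "bqo_state A B N u x" and t: "0 \<le> t"
  shows "ennreal ((norm (C *v x t + quad_output M (x t) (x t)))\<^sup>2) \<le>
     h2_norm_sq A B C N M *
       ennreal (exp (L2_norm_sq (input0 N u)) * L2_norm_sq u +
                exp (2 * L2_norm_sq (input0 N u)) * L2_norm_sq_kron u)"
proof -
  note Lu = L2_input_absolutely_integrable[OF u] and Lu0 = L2_input_absolutely_integrable[OF L2_input_input0[OF u, of N]]
  define c where "c = (\<lambda>i. weight (\<lambda>s. (norm (u s))\<^sup>2) (\<lambda>s. (norm (input0 N u s))\<^sup>2) i t)"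
  define K where "K = exp (L2_norm_sq (input0 N u)) * L2_norm_sq u"
  define xi where "xi = (\<lambda>i. volterra A B N u i t)"
  define X where "X = (\<lambda>n. \<Sum>i<n. xi i)"
  define HC where "HC = (\<lambda>i. \<integral>\<^sup>+t. ennreal (frobenius_sq (words (Suc i)) (h_C A B C N (Suc i) t)) \<partial>orthant (Suc i))"
  define HM where "HM = (\<lambda>i j. \<integral>\<^sup>+t. \<integral>\<^sup>+s. ennreal (frobenius_sq (words (Suc i) \<times> words (Suc j))
      (h_M A B N M (Suc i) (Suc j) t s)) \<partial>orthant (Suc j) \<partial>orthant (Suc i))"
  have c0: "0 \<le> c i" for i
    unfolding c_def by (rule weight_nonneg[OF Lu(1) _ Lu0(1)]) auto
  have cK: "(\<Sum>i<n. c i) \<le> K" for n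
    unfolding c_def K_def by (rule sum_weight_le[OF Lu(1) _ Lu0(1) _ Lu(3) Lu0(3) t]) auto
  have xi: "ennreal ((v \<bullet> xi i)\<^sup>2) \<le> ennreal (c i) * gramian_form A B N (Suc i) v" for v i
    unfolding xi_def c_def by (rule volterra_sq_le[OF Lu(2) Lu(1) Lu0(1)])
  have H: "(\<Sum>i<n. HC i) + (\<Sum>i<n. \<Sum>j<n. HM i j) \<le> h2_norm_sq A B C N M" for n
  proof -
    have "(\<Sum>i<n. \<Sum>j<n. HM i j) \<le> (\<Sum>i<n. \<Sum>j. HM i j)"
      by (intro sum_mono sum_le_suminf) auto
    also have "\<dots> \<le> (\<Sum>i. \<Sum>j. HM i j)" by (intro sum_le_suminf) auto
    finally have "(\<Sum>i<n. \<Sum>j<n. HM i j) \<le> (\<Sum>i. \<Sum>j. HM i j)" .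
    moreover have "(\<Sum>i<n. HC i) \<le> (\<Sum>i. HC i)" by (intro sum_le_suminf) auto
    ultimately show ?thesis
      unfolding h2_norm_sq_def HC_def HM_def by (rule add_mono[rotated])
  qed
  have partial: "ennreal ((norm (C *v X n + quad_output M (X n) (X n)))\<^sup>2)
      \<le> h2_norm_sq A B C N M * ennreal (K + K\<^sup>2)" for n
  proof -
    \<comment> \<open>One index set for both kinds of terms, so that a single Cauchy-Schwarz inequality yields the
      sum of the weights times the sum of the H2 terms.\<close>
    define I where "I = ({..<n} <+> ({..<n} \<times> {..<n}) :: (nat + nat \<times> nat) set)"
    define F where "F = case_sum (\<lambda>i. ennreal (norm (C *v xi i))) (\<lambda>(i, j). ennreal (norm (quad_output M (xi j) (xi i))))"
    define a where "a = case_sum (\<lambda>i. ennreal (c i)) (\<lambda>(i, j). ennreal (c i * c j))"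
    define b where "b = case_sum HC (\<lambda>(i, j). HM i j)"
    have "C *v X n = (\<Sum>i<n. C *v xi i)"
      unfolding X_def by (rule linear_sum) simp
    hence "norm (C *v X n) \<le> (\<Sum>i<n. norm (C *v xi i))" by (simp add: norm_sum)
    moreover have "norm (quad_output M (X n) (X n)) \<le> (\<Sum>(i, j)\<in>{..<n} \<times> {..<n}. norm (quad_output M (xi j) (xi i)))"
    proof -
      have "quad_output M (X n) (X n) = (\<Sum>i<n. \<Sum>j<n. quad_output M (xi j) (xi i))"
        unfolding X_def by (simp only: bounded_bilinear.sum_left[OF bounded_bilinear_quad_output]
            bounded_bilinear.sum_right[OF bounded_bilinear_quad_output])
      also have "\<dots> = (\<Sum>(i, j)\<in>{..<n} \<times> {..<n}. quad_output M (xi j) (xi i))"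
        by (rule sum.cartesian_product)
      finally show ?thesis
        using norm_sum[of "\<lambda>(i, j). quad_output M (xi j) (xi i)" "{..<n} \<times> {..<n}"] by (simp add: case_prod_beta)
    qed
    ultimately have "norm (C *v X n + quad_output M (X n) (X n))
        \<le> (\<Sum>i<n. norm (C *v xi i)) + (\<Sum>(i, j)\<in>{..<n} \<times> {..<n}. norm (quad_output M (xi j) (xi i)))"
      by (rule norm_triangle_mono)
    hence "ennreal (norm (C *v X n + quad_output M (X n) (X n))) \<le> (\<Sum>k\<in>I. F k)"
      unfolding I_def F_def
      by (subst sum.Plus) (auto simp: sum_ennreal case_prod_beta sum_nonneg ennreal_plus[symmetric] simp del: ennreal_plus intro!: ennreal_leI)
    hence "(ennreal (norm (C *v X n + quad_output M (X n) (X n))))\<^sup>2 \<le> (\<Sum>k\<in>I. F k)\<^sup>2"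
      by (rule power_mono) simp
    also have "\<dots> \<le> (\<Sum>k\<in>I. a k) * (\<Sum>k\<in>I. b k)"
    proof (rule sum_Cauchy_Schwarz_ennreal)
      show "finite I" by (simp add: I_def)
      fix k
      show "(F k)\<^sup>2 \<le> a k * b k"
      proof (cases k)
        case (Inl i)
        thus ?thesis
          unfolding F_def a_def b_def HC_def using linear_output_le[OF xi[of _ i]] by simp
      next
        case (Inr p)
        thus ?thesis
          unfolding F_def a_def b_def HM_def
          using quadratic_output_le[OF xi[of _ "fst p"] xi[of _ "snd p"] c0 c0] by (simp add: case_prod_beta)
      qed
    qed
    also have "(\<Sum>k\<in>I. b k) = (\<Sum>i<n. HC i) + (\<Sum>i<n. \<Sum>j<n. HM i j)"
      unfolding I_def b_def by (subst sum.Plus) (auto simp: sum.cartesian_product)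
    also have "\<dots> \<le> h2_norm_sq A B C N M" by (rule H)
    also have "(\<Sum>k\<in>I. a k) = ennreal ((\<Sum>i<n. c i) + (\<Sum>i<n. c i)\<^sup>2)"
      unfolding I_def a_def
      by (subst sum.Plus) (auto simp: sum_ennreal c0 sum_nonneg case_prod_beta power2_eq_square sum_product
          sum.cartesian_product ennreal_plus[symmetric] simp del: ennreal_plus)
    also have "\<dots> \<le> ennreal (K + K\<^sup>2)"
      using cK[of n] c0 by (intro ennreal_leI add_mono power_mono sum_nonneg) auto
    finally show ?thesis
      by (simp add: ennreal_power mult.commute mult_left_mono mult_right_mono)
  qed
  have "X \<longlonglongrightarrow> x t"
    unfolding X_def xi_def by (rule volterra_series_converges[OF Lu(2) x t])
  hence "(\<lambda>n. ennreal ((norm (C *v X n + quad_output M (X n) (X n)))\<^sup>2))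
      \<longlonglongrightarrow> ennreal ((norm (C *v x t + quad_output M (x t) (x t)))\<^sup>2)"
    by (intro tendsto_ennrealI tendsto_intros bounded_linear.tendsto[OF matrix_vector_mul_bounded_linear]
        bounded_bilinear.tendsto[OF bounded_bilinear_quad_output])
  hence "ennreal ((norm (C *v x t + quad_output M (x t) (x t)))\<^sup>2) \<le> h2_norm_sq A B C N M * ennreal (K + K\<^sup>2)"
    by (rule LIMSEQ_le_const2) (use partial in blast)
  thus ?thesis
    by (simp add: K_def L2_norm_sq_kron_eq power_mult_distrib exp_double)
qed

theorem theorem4p7:
  fixes A :: "real^'n^'n" and B :: "real^'m^'n" and C :: "real^'n^'p"
    and N :: "'m \<Rightarrow> real^'n^'n" and M :: "'p \<Rightarrow> real^'n^'n"
    and P :: "real^'n^'n"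
    and u :: "real \<Rightarrow> real^'m" and y :: "real \<Rightarrow> real^'p"
  assumes M_symmetric: "\<And>j. transpose (M j) = M j"
    and "stable A"
    and P_solution:
      "A ** P + P ** transpose A + (\<Sum>k\<in>UNIV. N k ** P ** transpose (N k)) + B ** transpose B = 0"
    and P_unique:
      "\<And>Q. A ** Q + Q ** transpose A + (\<Sum>k\<in>UNIV. N k ** Q ** transpose (N k)) + B ** transpose B = 0
         \<Longrightarrow> Q = P"
    and "symmetric_psd P"
    and "L2_input u"
    and "bqo_output A B C N M u y"
  shows "(SUP t\<in>{0..}. ennreal ((norm (y t))\<^sup>2)) \<le>
     h2_norm_sq A B C N M *
       ennreal (exp (L2_norm_sq (input0 N u)) * L2_norm_sq u +
                exp (2 * L2_norm_sq (input0 N u)) * L2_norm_sq_kron u)"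
proof (rule SUP_least)
  obtain x where x: "bqo_state A B N u x"
    and y: "\<And>t. t \<ge> 0 \<Longrightarrow> y t = C *v x t + quad_output M (x t) (x t)"
    using \<open>bqo_output A B C N M u y\<close> by (auto simp: bqo_output_def quad_output_def)
  show "ennreal ((norm (y t))\<^sup>2) \<le> h2_norm_sq A B C N M *
       ennreal (exp (L2_norm_sq (input0 N u)) * L2_norm_sq u +
                exp (2 * L2_norm_sq (input0 N u)) * L2_norm_sq_kron u)" if "t \<in> {0..}" for t
    using output_at_time_le[OF \<open>L2_input u\<close> x, of t C M] that y[of t] by simp
qed

end
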